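(* Call a triple $(i,j,r)$ of integers admissible if $i+j<0$ when $r$ is odd and $i+j\le0$ when $r$ is even. Then the set of monomials in $$\{E_i^{(m)},\ D_{k,l}^{(r)},\ G^{(t)}\mid i,k,l\in\{\pm1\},\ m>0,\ r>0,\ (k,l,r)\text{ admissible},\ t>0,\ t\text{ even}\},$$ taken in some fixed order, forms a (PBW) basis of the twisted Yangian $Y_3^+$ as a complex vector space.
   Context: **The twisted Yangian $Y_3^+$.** Let $\mathcal I=\{-1,0,1\}$. The Yangian $Y_3$ is the associative unital $\mathbb{C}$-algebra with generators $T_{i,j}^{(r)}$ ($i,j\in\mathcal I$, $r\ge1$) and relations $[T_{i,j}(u),T_{k,l}(v)]=\frac1{u-v}\big(T_{k,j}(u)T_{i,l}(v)-T_{k,j}(v)T_{i,l}(u)\big)$, where $T_{i,j}(u)=\sum_{r\ge0}T_{i,j}^{(r)}u^{-r}$, $T_{i,j}^{(0)}=\delta_{i,j}$, and $\frac1{u-v}=\sum_{r\ge0}u^{-r-1}v^r$. There is an involutive automorphism $\eta$ of $Y_3$ with $\eta(T_{i,j}(u))=T_{-j,-i}(-u)$. Put $S_{i,j}(u)=\sum_{r\ge0}S_{i,j}^{(r)}u^{-r}=\sum_{k\in\mathcal I}\eta(T_{i,k}(u))T_{k,j}(u)$. Then $Y_3^+$, the twisted Yangian associated to $\mathfrak{so}_3(\mathbb C)$, is the subalgebra of $Y_3$ generated by all $S_{i,j}^{(r)}$, $i,j\in\mathcal I$, $r\ge1$. **Drinfeld generators.** For $i,j\in\{\pm1\}$ let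 $D_{i,j}(u)=S_{i,j}(u)$, let $D(u)$ be the $2\times2$ matrix $(D_{i,j}(u))_{i,j\in\{\pm1\}}$, and let $\tilde D(u)=(\tilde D_{i,j}(u))=D(u)^{-1}$. Define, with sums over $a,b\in\{\pm1\}$, $E_i(u)=\sum_a\tilde D_{i,a}(u)S_{a,0}(u)$ and $G(u)=S_{0,0}(u)-\sum_{a,b}S_{0,a}(u)\tilde D_{a,b}(u)S_{b,0}(u)$. For $X\in\{D_{i,j},E_i,G\}$, $X^{(r)}\in Y_3^+$ denotes the coefficient of $u^{-r}$ in $X(u)$. *)

theory Defs
  imports
    "HOL-Analysis.Finite_Cartesian_Product"
    "HOL-Computational_Algebra.Formal_Power_Series"
    "HOL-Library.Poly_Mapping"
begin

section \<open>Index sets\<close>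

text \<open>\<open>pm\<close> is the index set of \<open>\<plusminus>1\<close>, and \<open>idx\<close> is \<open>{-1, 0, 1}\<close>, into which \<open>pm\<close> is
  embedded by \<open>Sgn\<close>.\<close>

datatype pm = Minus | Plus

datatype idx = Zero | Sgn pm

lemma UNIV_pm: "UNIV = {Minus, Plus}"
  by (auto intro: pm.exhaust)

lemma UNIV_idx: "UNIV = {Sgn Minus, Zero, Sgn Plus}"
proof (intro set_eqI iffI)
  fix x :: idx
  show "x \<in> {Sgn Minus, Zero, Sgn Plus}"
    by (cases x; cases "case x of Sgn s \<Rightarrow> s") auto
qed auto

instance pm :: finite
  by standard (simp add: UNIV_pm)

instance idx :: finite
  by standard (simp add: UNIV_idx)

fun int_of_pm :: "pm \<Rightarrow> int" where
  "int_of_pm Minus = - 1"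
| "int_of_pm Plus = 1"

instantiation idx :: uminus
begin

fun uminus_idx :: "idx \<Rightarrow> idx" where
  "- Zero = Zero"
| "- Sgn Minus = Sgn Plus"
| "- Sgn Plus = Sgn Minus"

instance ..

end

lemma idx_minus_minus [simp]: "- (- i) = (i :: idx)"
  by (cases i rule: uminus_idx.cases) auto

lemma idx_minus_eq_iff [simp]: "- i = - j \<longleftrightarrow> i = (j :: idx)"
  by (metis idx_minus_minus)


section \<open>The free algebra on the generators of the Yangian\<close>

text \<open>\<open>Gen i j n\<close> is the generator $T_{i,j}^{(n+1)}$; the shift makes the superscripts run over
  the positive integers. Words in the generators form the free monoid, written additively so that
  finitely supported functions on words carry the convolution product of \<open>Poly_Mapping\<close>.\<close>

datatype gen = Gen idx idx nat

datatype word = Word (letters: "gen list")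

instantiation word :: monoid_add
begin

definition "0 = Word []"

definition "v + w = Word (letters v @ letters w)"

instance
  by standard (simp_all add: zero_word_def plus_word_def)

end

lemma letters_zero [simp]: "letters 0 = []"
  by (simp add: zero_word_def)

lemma letters_plus [simp]: "letters (v + w) = letters v @ letters w"
  by (simp add: plus_word_def)

type_synonym falg = "word \<Rightarrow>\<^sub>0 complex"

definition fconst :: "complex \<Rightarrow> falg" where
  "fconst c = Poly_Mapping.single 0 c"

definition fT :: "idx \<Rightarrow> idx \<Rightarrow> nat \<Rightarrow> falg" where
  "fT i j r = (if r = 0 then of_bool (i = j) else Poly_Mapping.single (Word [Gen i j (r - 1)]) 1)"

lemma falg_induct [case_names single add]:
  assumes "\<And>w c. P (Poly_Mapping.single w c)" and "\<And>p q. P p \<Longrightarrow> P q \<Longrightarrow> P (p + q)"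
  shows "P (p :: falg)"
proof (induction p rule: update_induct)
  case const
  show ?case using assms(1)[of 0 0] by simp
next
  case (update f a b)
  have "Poly_Mapping.update a b f = Poly_Mapping.single a b + f"
    using update(1)
    by (intro poly_mapping_eqI) (auto simp: lookup_update lookup_add lookup_single in_keys_iff)
  with update assms show ?case by simp
qed

lemma fconst_commute: "fconst c * p = p * fconst c"
  by (induction p rule: falg_induct) (simp_all add: fconst_def mult_single algebra_simps)

lemma fconst_simps:
  "fconst 0 = 0" "fconst 1 = 1"
  "fconst (a + b) = fconst a + fconst b" "fconst (a * b) = fconst a * fconst b"
  by (simp_all add: fconst_def mult_single single_add)

text \<open>The algebra homomorphism extending a map \<open>f\<close> on generators, where \<open>c\<close> is the structure map
  of the scalars into the target.\<close>

definition free_eval :: "(complex \<Rightarrow> 'b) \<Rightarrow> (gen \<Rightarrow> 'b) \<Rightarrow> falg \<Rightarrow> 'b :: ring_1" where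
  "free_eval c f p =
     (\<Sum>w\<in>Poly_Mapping.keys p. c (Poly_Mapping.lookup p w) * prod_list (map f (letters w)))"

locale scalar_map =
  fixes c :: "complex \<Rightarrow> 'b :: ring_1"
  assumes c_zero: "c 0 = 0" and c_one: "c 1 = 1"
    and c_add: "c (a + b) = c a + c b" and c_mult: "c (a * b) = c a * c b"
    and c_central: "c a * x = x * c a"
begin

lemma eval_single: "free_eval c f (Poly_Mapping.single w a) = c a * prod_list (map f (letters w))"
  by (simp add: free_eval_def c_zero)

lemma eval_add: "free_eval c f (p + q) = free_eval c f p + free_eval c f q"
  unfolding free_eval_def
  by (rule setsum_keys_plus_distrib) (simp_all add: c_zero c_add algebra_simps)

lemma eval_mult: "free_eval c f (p * q) = free_eval c f p * free_eval c f q"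
proof (induction p rule: falg_induct)
  case (single w a)
  show ?case
  proof (induction q rule: falg_induct)
    case (single v b)
    have "c a * c b * (x * y) = c a * x * (c b * y)" for x y
      by (metis c_central mult.assoc)
    then show ?case by (simp add: mult_single eval_single c_mult)
  qed (simp add: algebra_simps eval_add)
qed (simp add: algebra_simps eval_add)

lemma eval_zero: "free_eval c f 0 = 0"
  by (simp add: free_eval_def)

lemma eval_one: "free_eval c f 1 = 1"
  using eval_single[of f 0 1] by (simp add: c_one)

lemma eval_const: "free_eval c f (fconst a) = c a"
  by (simp add: fconst_def eval_single)

lemma eval_uminus: "free_eval c f (- p) = - free_eval c f p"
  using eval_add[of f p "- p"] by (simp add: eval_zero add_eq_0_iff)

lemma eval_diff: "free_eval c f (p - q) = free_eval c f p - free_eval c f q"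
  using eval_add[of f p "- q"] by (simp add: eval_uminus)

lemma eval_sum: "free_eval c f (sum g A) = (\<Sum>a\<in>A. free_eval c f (g a))"
  by (induction A rule: infinite_finite_induct) (simp_all add: eval_zero eval_add)

lemma eval_T:
  "free_eval c f (fT i j r) = (if r = 0 then of_bool (i = j) else f (Gen i j (r - 1)))"
  by (simp add: fT_def eval_single eval_zero eval_one c_one)

end

interpretation falg: scalar_map fconst
  by standard (rule fconst_simps fconst_commute)+

interpretation cplx: scalar_map "\<lambda>c. c"
  by standard (simp_all add: algebra_simps)


section \<open>The Yangian\<close>

text \<open>The coefficient of $u^{-r} v^{-s}$ in the difference of the two sides of
  \[ [T_{i,j}(u), T_{k,l}(v)] = \frac{1}{u-v} (T_{k,j}(u) T_{i,l}(v) - T_{k,j}(v) T_{i,l}(u)), \]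
  with $1/(u-v) = \sum_{a \ge 0} u^{-a-1} v^a$. The coefficients at $u^{-r} v^s$ with \<open>s > 0\<close>,
  which also occur on the right hand side, are sums of $X^{(p)} Y^{(q)} - X^{(q)} Y^{(p)}$ over all
  \<open>p + q = r - 1 - s\<close>, hence zero already in the free algebra.\<close>

definition yrel :: "idx \<Rightarrow> idx \<Rightarrow> idx \<Rightarrow> idx \<Rightarrow> nat \<Rightarrow> nat \<Rightarrow> falg" where
  "yrel i j k l r s =
     (fT i j r * fT k l s - fT k l s * fT i j r) -
     (\<Sum>a<r. fT k j (r - 1 - a) * fT i l (s + a) - fT k j (s + a) * fT i l (r - 1 - a))"

inductive_set yideal :: "falg set" where
  zero: "0 \<in> yideal"
| add: "x \<in> yideal \<Longrightarrow> y \<in> yideal \<Longrightarrow> x + y \<in> yideal"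
| rel: "p * yrel i j k l r s * q \<in> yideal"

lemma yideal_left: "x \<in> yideal \<Longrightarrow> p * x \<in> yideal"
proof (induction rule: yideal.induct)
  case (rel q i j k l r s q')
  show ?case using yideal.rel[of "p * q" i j k l r s q'] by (simp add: mult.assoc)
qed (simp_all add: distrib_left yideal.zero yideal.add)

lemma yideal_right: "x \<in> yideal \<Longrightarrow> x * p \<in> yideal"
proof (induction rule: yideal.induct)
  case (rel q i j k l r s q')
  show ?case using yideal.rel[of q i j k l r s "q' * p"] by (simp add: mult.assoc)
qed (simp_all add: distrib_right yideal.zero yideal.add)

lemma yideal_uminus: "x \<in> yideal \<Longrightarrow> - x \<in> yideal"
  using yideal_left[of x "- 1"] by simp

lemma yideal_diff: "x \<in> yideal \<Longrightarrow> y \<in> yideal \<Longrightarrow> x - y \<in> yideal"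
  using yideal.add[of x "- y"] yideal_uminus[of y] by simp

lemma yrel_in: "yrel i j k l r s \<in> yideal"
  using yideal.rel[of 1 i j k l r s 1] by simp

text \<open>The character $T_{i,j}^{(r)} \mapsto 0$ shows that the quotient is not the zero ring.\<close>

lemma eval0_yideal: "x \<in> yideal \<Longrightarrow> free_eval (\<lambda>c. c) (\<lambda>_. 0) x = 0"
proof (induction rule: yideal.induct)
  case (rel p i j k l r s q)
  have T: "free_eval (\<lambda>c. c) (\<lambda>_. 0) (fT i j r) = of_bool (i = j) * of_bool (r = 0)" for i j r
    by (simp add: cplx.eval_T)
  have "free_eval (\<lambda>c. c) (\<lambda>_. 0) (yrel i j k l r s) = 0"
    unfolding yrel_def cplx.eval_diff cplx.eval_mult cplx.eval_sum T
    by (auto intro!: sum.neutral)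
  then show ?case by (simp add: cplx.eval_mult)
qed (simp_all add: cplx.eval_zero cplx.eval_add)

lemma one_notin_yideal: "1 \<notin> yideal"
  using eval0_yideal[of 1] by (auto simp: cplx.eval_one)

quotient_type yangian3 = falg / "\<lambda>x y. x - y \<in> yideal"
proof (rule equivpI)
  show "reflp (\<lambda>x y. x - y \<in> yideal)"
    by (simp add: reflp_def yideal.zero)
  show "symp (\<lambda>x y. x - y \<in> yideal)"
    by (rule sympI) (metis minus_diff_eq yideal_uminus)
  show "transp (\<lambda>x y. x - y \<in> yideal)"
  proof (rule transpI)
    fix x y z :: falg
    assume "x - y \<in> yideal" "y - z \<in> yideal"
    then show "x - z \<in> yideal" using yideal.add[of "x - y" "y - z"] by simp
  qed
qed

instantiation yangian3 :: ring_1
begin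

lift_definition zero_yangian3 :: yangian3 is 0 .

lift_definition one_yangian3 :: yangian3 is 1 .

lift_definition plus_yangian3 :: "yangian3 \<Rightarrow> yangian3 \<Rightarrow> yangian3" is "(+)"
  by (metis add_diff_add yideal.add)

lift_definition uminus_yangian3 :: "yangian3 \<Rightarrow> yangian3" is uminus
  by (metis minus_diff_minus yideal_uminus)

lift_definition minus_yangian3 :: "yangian3 \<Rightarrow> yangian3 \<Rightarrow> yangian3" is "(-)"
proof -
  fix x x' y y' :: falg
  assume "x - x' \<in> yideal" "y - y' \<in> yideal"
  moreover have "x - y - (x' - y') = (x - x') - (y - y')" by simp
  ultimately show "x - y - (x' - y') \<in> yideal" by (metis yideal_diff)
qed

lift_definition times_yangian3 :: "yangian3 \<Rightarrow> yangian3 \<Rightarrow> yangian3" is "(*)"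
proof -
  fix x x' y y' :: falg
  assume "x - x' \<in> yideal" "y - y' \<in> yideal"
  moreover have "x * y - x' * y' = (x - x') * y + x' * (y - y')"
    by (simp add: algebra_simps)
  ultimately show "x * y - x' * y' \<in> yideal"
    by (simp add: yideal.add yideal_left yideal_right)
qed

lemma zero_neq_one_yangian3: "(0 :: yangian3) \<noteq> 1"
  by transfer (use one_notin_yideal yideal_uminus[of "- 1"] in auto)

instance
  by standard
    ((rule zero_neq_one_yangian3 | transfer, simp add: algebra_simps yideal.zero)+)

end

lift_definition yscale :: "complex \<Rightarrow> yangian3 \<Rightarrow> yangian3" is "\<lambda>c x. fconst c * x"
  by (metis right_diff_distrib yideal_left)

lift_definition yT :: "idx \<Rightarrow> idx \<Rightarrow> nat \<Rightarrow> yangian3" is fT .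

global_interpretation Y: vector_space yscale
  by standard (transfer; simp add: fconst_simps algebra_simps yideal.zero)+

lemma yscale_mult_left: "yscale c x * y = yscale c (x * y)"
  by transfer (simp add: mult.assoc yideal.zero)

lemma yscale_mult_right: "x * yscale c y = yscale c (x * y)"
  by transfer (metis fconst_commute mult.assoc diff_self yideal.zero)

lemma yT_0: "yT i j 0 = of_bool (i = j)"
  by (cases "i = j") (simp_all add: yT.abs_eq fT_def one_yangian3.abs_eq zero_yangian3.abs_eq)

lemma yT_commutator:
  "yT i j r * yT k l s - yT k l s * yT i j r =
     (\<Sum>a<r. yT k j (r - 1 - a) * yT i l (s + a) - yT k j (s + a) * yT i l (r - 1 - a))"
proof -
  have abs_sum: "abs_yangian3 (sum f A) = (\<Sum>a\<in>A. abs_yangian3 (f a))"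
    for f :: "nat \<Rightarrow> falg" and A
    by (induction A rule: infinite_finite_induct)
      (simp_all add: plus_yangian3.abs_eq[symmetric] zero_yangian3.abs_eq[symmetric])
  have "abs_yangian3 (yrel i j k l r s) = 0"
    unfolding zero_yangian3.abs_eq yangian3.abs_eq_iff by (simp add: yrel_in)
  then show ?thesis
    unfolding yrel_def minus_yangian3.abs_eq[symmetric] abs_sum times_yangian3.abs_eq[symmetric]
      yT.abs_eq[symmetric]
    by simp
qed


section \<open>The automorphism \<open>\<eta>\<close>\<close>

text \<open>In terms of coefficients, $\eta(T_{i,j}(u)) = T_{-j,-i}(-u)$ says
  $\eta(T_{i,j}^{(r)}) = (-1)^r T_{-j,-i}^{(r)}$.\<close>

fun feta_gen :: "gen \<Rightarrow> falg" where
  "feta_gen (Gen i j n) = (- 1) ^ (n + 1) * fT (- j) (- i) (n + 1)"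

definition feta :: "falg \<Rightarrow> falg" where
  "feta = free_eval fconst feta_gen"

lemma feta_T: "feta (fT i j r) = (- 1) ^ r * fT (- j) (- i) r"
  unfolding feta_def falg.eval_T by (cases r) (auto simp: fT_def)

lemma feta_T_mult:
  "feta (fT i j r * fT k l s) = (- 1) ^ (r + s) * (fT (- j) (- i) r * fT (- l) (- k) s)"
proof -
  have "feta (fT i j r * fT k l s) = feta (fT i j r) * feta (fT k l s)"
    by (simp add: feta_def falg.eval_mult)
  then show ?thesis
    by (cases "even r"; cases "even s") (simp_all add: feta_T)
qed

lemma antisymmetric_sum:
  fixes h :: "nat \<Rightarrow> nat \<Rightarrow> 'a :: ab_group_add"
  shows "(\<Sum>a<s. h (s - 1 - a) (r + a) - h (r + a) (s - 1 - a)) =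
    (\<Sum>a<r. h (r - 1 - a) (s + a) - h (s + a) (r - 1 - a))"
proof -
  define H where "H p = h p (r + s - 1 - p)" for p
  have shift: "(\<Sum>a<n. H (m + a)) = sum H {..<m + n} - sum H {..<m}" for m n
    by (induction n) simp_all
  have H1: "H (m - Suc a) = h (m - 1 - a) (n + a)" "H (n + a) = h (n + a) (m - 1 - a)"
    if "a < m" "m + n = r + s" for a m n
  proof -
    have "r + s - 1 - (m - Suc a) = n + a" "r + s - 1 - (n + a) = m - 1 - a"
      using that by simp_all
    then show "H (m - Suc a) = h (m - 1 - a) (n + a)" "H (n + a) = h (n + a) (m - 1 - a)"
      by (simp_all add: H_def)
  qed
  have "(\<Sum>a<s. h (s - 1 - a) (r + a) - h (r + a) (s - 1 - a)) =
      (\<Sum>a<s. H (s - Suc a)) - (\<Sum>a<s. H (r + a))"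
    unfolding sum_subtractf[symmetric] by (intro sum.cong refl) (simp add: H1[of _ s r])
  also have "\<dots> = (\<Sum>a<r. H (r - Suc a)) - (\<Sum>a<r. H (s + a))"
    unfolding sum.nat_diff_reindex shift by (simp add: add.commute)
  also have "\<dots> = (\<Sum>a<r. h (r - 1 - a) (s + a) - h (s + a) (r - 1 - a))"
    unfolding sum_subtractf[symmetric] by (intro sum.cong refl) (simp add: H1[of _ r s])
  finally show ?thesis .
qed

lemma feta_yrel: "feta (yrel i j k l r s) = (- 1) ^ (r + s + 1) * yrel (- l) (- k) (- j) (- i) s r"
proof -
  define e :: falg where "e = (- 1) ^ (r + s)"
  define h where "h p q = fT (- j) (- k) p * fT (- l) (- i) q" for p q
  have sign: "(- 1) ^ (r - 1 - a + (s + a)) = - e" "(- 1) ^ (s + a + (r - 1 - a)) = - e"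
    if "a < r" for a
  proof -
    obtain n where n: "r - 1 - a + (s + a) = n" by blast
    with that have "r + s = Suc n" by simp
    then have "(- 1) ^ n = - e" by (simp add: e_def)
    with n show "(- 1) ^ (r - 1 - a + (s + a)) = - e" "(- 1) ^ (s + a + (r - 1 - a)) = - e"
      by (simp_all only: add.commute[of "s + a"])
  qed
  have "feta (yrel i j k l r s) =
      e * (fT (- j) (- i) r * fT (- l) (- k) s) - e * (fT (- l) (- k) s * fT (- j) (- i) r) -
      (\<Sum>a<r. feta (fT k j (r - 1 - a) * fT i l (s + a)) -
        feta (fT k j (s + a) * fT i l (r - 1 - a)))"
  proof -
    have "e * (fT (- l) (- k) s * fT (- j) (- i) r) = feta (fT k l s * fT i j r)"
      unfolding feta_T_mult e_def by (simp only: add.commute[of s r])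
    moreover have "e * (fT (- j) (- i) r * fT (- l) (- k) s) = feta (fT i j r * fT k l s)"
      by (simp only: feta_T_mult e_def)
    ultimately show ?thesis
      by (simp only: yrel_def feta_def falg.eval_diff falg.eval_sum)
  qed
  also have "(\<Sum>a<r. feta (fT k j (r - 1 - a) * fT i l (s + a)) -
        feta (fT k j (s + a) * fT i l (r - 1 - a))) =
      (\<Sum>a<r. - e * (h (r - 1 - a) (s + a) - h (s + a) (r - 1 - a)))"
    by (intro sum.cong refl) (simp only: feta_T_mult sign h_def right_diff_distrib lessThan_iff)
  also have "\<dots> = - e * (\<Sum>a<s. h (s - 1 - a) (r + a) - h (r + a) (s - 1 - a))"
    unfolding sum_distrib_left[symmetric] by (simp only: antisymmetric_sum)
  finally show ?thesis
    by (simp add: yrel_def h_def e_def right_diff_distrib)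
qed

lemma feta_yideal: "x \<in> yideal \<Longrightarrow> feta x \<in> yideal"
proof (induction rule: yideal.induct)
  case (rel p i j k l r s q)
  show ?case
    unfolding feta_def falg.eval_mult
    unfolding feta_def[symmetric] feta_yrel
    by (intro yideal_left yideal_right yrel_in)
qed (simp_all add: feta_def falg.eval_zero falg.eval_add yideal.zero yideal.add)

lift_definition eta :: "yangian3 \<Rightarrow> yangian3" is feta
proof -
  fix x y :: falg
  assume "x - y \<in> yideal"
  then have "feta (x - y) \<in> yideal" by (rule feta_yideal)
  then show "feta x - feta y \<in> yideal" by (simp add: feta_def falg.eval_diff)
qed

lemma eta_add: "eta (x + y) = eta x + eta y"
  by transfer (simp add: feta_def falg.eval_add yideal.zero)

lemma eta_mult: "eta (x * y) = eta x * eta y"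
  by transfer (simp add: feta_def falg.eval_mult yideal.zero)

lemma eta_one: "eta 1 = 1"
  by transfer (simp add: feta_def falg.eval_one yideal.zero)

lemma eta_scale: "eta (yscale c x) = yscale c (eta x)"
  by transfer (simp add: feta_def falg.eval_mult falg.eval_const yideal.zero)

lemma eta_T: "eta (yT i j r) = (- 1) ^ r * yT (- j) (- i) r"
proof -
  have "eta (yT i j r) = abs_yangian3 ((- 1) ^ r * fT (- j) (- i) r)"
    by (simp add: yT.abs_eq eta.abs_eq feta_T)
  also have "\<dots> = (- 1) ^ r * yT (- j) (- i) r"
    by (cases "even r")
      (simp_all add: yT.abs_eq uminus_yangian3.abs_eq)
  finally show ?thesis .
qed


section \<open>The twisted Yangian\<close>

text \<open>Power series in $u^{-1}$ with coefficients in the Yangian are elements of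
  \<open>yangian3 fps\<close>, with \<open>fps_X\<close> in the role of $u^{-1}$.\<close>

definition Tser :: "idx \<Rightarrow> idx \<Rightarrow> yangian3 fps" where
  "Tser i j = Abs_fps (yT i j)"

definition Sser :: "idx \<Rightarrow> idx \<Rightarrow> yangian3 fps" where
  "Sser i j = (\<Sum>k\<in>UNIV. Abs_fps (\<lambda>r. eta (fps_nth (Tser i k) r)) * Tser k j)"

definition subalgebra :: "yangian3 set \<Rightarrow> bool" where
  "subalgebra A \<longleftrightarrow> 1 \<in> A \<and> (\<forall>x\<in>A. \<forall>y\<in>A. x + y \<in> A \<and> x * y \<in> A) \<and> (\<forall>c. \<forall>x\<in>A. yscale c x \<in> A)"

definition twisted_yangian :: "yangian3 set" where
  "twisted_yangian = subalgebra hull {fps_nth (Sser i j) r | i j r. r \<ge> 1}"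


section \<open>Drinfeld generators and PBW monomials\<close>

definition Dser :: "pm \<Rightarrow> pm \<Rightarrow> yangian3 fps" where
  "Dser i j = Sser (Sgn i) (Sgn j)"

definition Dmat :: "yangian3 fps ^ pm ^ pm" where
  "Dmat = (\<chi> i j. Dser i j)"

definition Dtilde :: "pm \<Rightarrow> pm \<Rightarrow> yangian3 fps" where
  "Dtilde i j = vec_nth (vec_nth (matrix_inv Dmat) i) j"

definition Eser :: "pm \<Rightarrow> yangian3 fps" where
  "Eser i = (\<Sum>a\<in>UNIV. Dtilde i a * Sser (Sgn a) Zero)"

definition Gser :: "yangian3 fps" where
  "Gser = Sser Zero Zero -
     (\<Sum>a\<in>UNIV. \<Sum>b\<in>UNIV. Sser Zero (Sgn a) * Dtilde a b * Sser (Sgn b) Zero)"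

definition admissible :: "int \<Rightarrow> int \<Rightarrow> int \<Rightarrow> bool" where
  "admissible i j r \<longleftrightarrow> (odd r \<longrightarrow> i + j < 0) \<and> (even r \<longrightarrow> i + j \<le> 0)"

text \<open>Labels for the elements $E_i^{(m)}$, $D_{k,l}^{(r)}$ and $G^{(t)}$.\<close>

datatype label = EGen pm nat | DGen pm pm nat | GGen nat

fun drinfeld :: "label \<Rightarrow> yangian3" where
  "drinfeld (EGen i m) = fps_nth (Eser i) m"
| "drinfeld (DGen k l r) = fps_nth (Dser k l) r"
| "drinfeld (GGen t) = fps_nth Gser t"

definition pbw_labels :: "label set" where
  "pbw_labels = {EGen i m | i m. m > 0} \<union>
     {DGen k l r | k l r. r > 0 \<and> admissible (int_of_pm k) (int_of_pm l) (int r)} \<union>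
     {GGen t | t. t > 0 \<and> even t}"

text \<open>The exponent data of an ordered monomial, as the weakly increasing list of its factors.\<close>

definition ordered_words :: "label rel \<Rightarrow> label list set" where
  "ordered_words ord = {xs. set xs \<subseteq> pbw_labels \<and> sorted_wrt (\<lambda>x y. (x, y) \<in> ord) xs}"

definition pbw_monomial :: "label list \<Rightarrow> yangian3" where
  "pbw_monomial xs = prod_list (map drinfeld xs)"

end

theory Submission
  imports Defs
    "HOL-Computational_Algebra.Polynomial_FPS"
    "HOL-Computational_Algebra.Fundamental_Theorem_Algebra"
begin

text \<open>Give $S_{i,j}^{(r)}$ weight \<open>r\<close>. The RTT relation for \<open>T\<close> and for \<open>\<eta>(T)\<close> implies the reflection
  equation for \<open>S\<close>, which shows that commutators lower the weight of a product, while comparing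
  $S_{i,j}(u)$ with $S_{-j,-i}(-u)$ makes the non-admissible generators redundant. As \<open>D E\<close> and
  \<open>G\<close> determine the remaining entries of \<open>S\<close> recursively, ordered monomials span.

  For independence, the Yangian acts on all functions of \<open>k \<in> \<complex>\<^sup>3\<^sup>n\<close> through products of \<open>n\<close>
  factors \<open>1 + E u\<^sup>-\<^sup>1\<close>, where \<open>E\<close> is the oscillator realization of $\mathfrak{gl}_3$ by difference
  operators. Letting \<open>k\<close> tend to infinity along a line, $T^{(r)}$ grows with order \<open>r\<close> and its leading
  symbols are the coefficients of a product of matrices \<open>1 + M u\<^sup>-\<^sup>1\<close> with \<open>M\<close> of rank one. Such
  products approximate every matrix series \<open>\<tau>\<close> with \<open>\<tau>(\<infinity>) = 1\<close> to any order. Hence, taking for \<open>\<tau>\<close>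
  the square root of a suitable symmetric series, the leading symbols of the Drinfeld generators can
  be prescribed arbitrarily, and a linear relation between ordered monomials would be a polynomial
  vanishing identically.\<close>

section \<open>Tensor legs\<close>

type_synonym 'a mat2 = "'a ^ (idx \<times> idx) ^ (idx \<times> idx)"

text \<open>The matrix \<open>A \<otimes> 1\<close> on the tensor square, as
  \<open>snd_leg A\<close> is \<open>1 \<otimes> A\<close>. The entries need not commute, so
  products of the two legs depend on their order.\<close>

definition fst_leg :: "(idx \<Rightarrow> idx \<Rightarrow> 'a) \<Rightarrow> 'a::ring_1 mat2" where
  "fst_leg A = (\<chi> p q. if snd p = snd q then A (fst p) (fst q) else 0)"

definition snd_leg :: "(idx \<Rightarrow> idx \<Rightarrow> 'a) \<Rightarrow> 'a::ring_1 mat2" where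
  "snd_leg A = (\<chi> p q. if fst p = fst q then A (snd p) (snd q) else 0)"

text \<open>The flip \<open>P\<close> of the two tensor factors; \<open>contrm\<close> is its
  partial transpose \<open>Q\<close> for the form pairing \<open>i\<close> with \<open>- i\<close>.
  The conditions are nested so that the indices of a matrix product can be summed out one at a
  time.\<close>

definition swapm :: "'a::ring_1 mat2" where
  "swapm = (\<chi> p q. if snd p = fst q then if fst p = snd q then 1 else 0 else 0)"

definition contrm :: "'a::ring_1 mat2" where
  "contrm = (\<chi> p q. if fst p = - snd p then if fst q = - snd q then 1 else 0 else 0)"

lemma sum_UNIV_pair: "(\<Sum>p\<in>UNIV. f p) = (\<Sum>a\<in>UNIV. \<Sum>b\<in>UNIV. f (a, b))"
  for f :: "idx \<times> idx \<Rightarrow> 'a::comm_monoid_add"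
  by (simp add: sum.cartesian_product)

lemma sum_uminus_idx: "(\<Sum>k\<in>UNIV. f (- k :: idx)) = (\<Sum>k\<in>UNIV. f k)"
  by (simp add: UNIV_idx add_ac)

lemma if_zero_mult: "(if c then x else 0) * (y::'a::ring_1) = (if c then x * y else 0)"
  "y * (if c then x else 0) = (if c then y * x else 0)"
  by auto

lemmas mat2_simps = matrix_matrix_mult_def sum_UNIV_pair if_zero_mult fst_leg_def snd_leg_def
  swapm_def contrm_def

lemma if_sum_out: "(\<Sum>x\<in>S. if c then f x else 0) = (if c then sum f S else (0::'a::comm_monoid_add))"
  by auto

lemma fst_snd_leg_nth: "(fst_leg A ** snd_leg B) $ (i, k) $ (j, l) = A i j * B k l"
  by (simp add: mat2_simps if_sum_out cong: if_cong)

lemma snd_fst_leg_nth: "(snd_leg B ** fst_leg A) $ (i, k) $ (j, l) = B k l * A i j"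
  by (simp add: mat2_simps if_sum_out cong: if_cong)

lemma fst_fst_leg: "fst_leg A ** fst_leg B = fst_leg (\<lambda>i j. \<Sum>a\<in>UNIV. A i a * B a j)"
  by (simp add: vec_eq_iff split_paired_all mat2_simps if_sum_out cong: if_cong)

lemma snd_snd_leg: "snd_leg A ** snd_leg B = snd_leg (\<lambda>i j. \<Sum>a\<in>UNIV. A i a * B a j)"
  by (simp add: vec_eq_iff split_paired_all mat2_simps if_sum_out cong: if_cong)

lemma swapm_mult_nth: "(swapm ** M) $ (i, k) $ q = M $ (k, i) $ q"
  by (simp add: mat2_simps if_sum_out cong: if_cong)

lemma mult_swapm_nth: "(M ** swapm) $ p $ (j, l) = M $ p $ (l, j)"
  by (simp add: mat2_simps if_sum_out eq_commute cong: if_cong)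

lemma eq_uminus_idx: "i = - j \<longleftrightarrow> j = - (i :: idx)"
  by (metis idx_minus_minus)

lemma fst_contrm_nth:
  "(fst_leg A ** contrm) $ (i, k) $ (j, l) = (if j = - l then A i (- k) else 0)"
  unfolding matrix_matrix_mult_def sum_UNIV_pair
  by (subst sum.swap) (simp add: mat2_simps if_sum_out cong: if_cong)

lemma snd_contrm_nth:
  "(snd_leg B ** contrm) $ (i, k) $ (j, l) = (if j = - l then B k (- i) else 0)"
  unfolding matrix_matrix_mult_def sum_UNIV_pair
  by (subst sum.swap) (simp add: mat2_simps if_sum_out eq_uminus_idx[of i] cong: if_cong)

lemma fst_contrm_snd_nth:
  "(fst_leg A ** contrm ** snd_leg B) $ (i, k) $ (j, l) = A i (- k) * B (- j) l"
  unfolding matrix_matrix_mult_def[of "_ ** _"] sum_UNIV_pair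
  by (simp add: fst_contrm_nth snd_leg_def if_zero_mult if_sum_out eq_uminus_idx[of j] cong: if_cong)

lemma snd_contrm_fst_nth:
  "(snd_leg B ** contrm ** fst_leg A) $ (i, k) $ (j, l) = B k (- i) * A (- l) j"
  unfolding matrix_matrix_mult_def[of "_ ** _"] sum_UNIV_pair
  by (simp add: snd_contrm_nth fst_leg_def if_zero_mult if_sum_out cong: if_cong)

section \<open>R-matrices with central coefficients\<close>

definition central :: "'a::ring_1 \<Rightarrow> bool" where
  "central z \<longleftrightarrow> (\<forall>a. z * a = a * z)"

lemma mat_mult_nth: "(mat z ** M) $ p $ q = z * M $ p $ q"
  for M :: "'a::ring_1 ^ 'n::finite ^ 'm::finite"
  by (simp add: matrix_matrix_mult_def mat_def if_zero_mult)

lemma mult_mat_nth: "(M ** mat z) $ p $ q = M $ p $ q * z"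
  for M :: "'a::ring_1 ^ 'n::finite ^ 'm::finite"
  by (simp add: matrix_matrix_mult_def mat_def if_zero_mult)

lemma central_mat: "central z \<Longrightarrow> mat z ** M = M ** mat z"
  for M :: "'a::ring_1 ^ 'n::finite ^ 'm::finite"
  by (simp add: vec_eq_iff mat_mult_nth mult_mat_nth central_def)

lemma matrix_add_rdistrib: "(A + B) ** C = A ** C + B ** C"
  for A :: "'a::ring_1 ^ 'n::finite ^ 'm::finite" and C :: "'a ^ 'k::finite ^ 'n"
  by (simp add: vec_eq_iff matrix_matrix_mult_def distrib_right sum.distrib)

definition Rmat :: "'a \<Rightarrow> 'a \<Rightarrow> 'a::ring_1 mat2" where
  "Rmat x y = mat x + mat y ** swapm"

definition Rtmat :: "'a \<Rightarrow> 'a \<Rightarrow> 'a::ring_1 mat2" where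
  "Rtmat x y = mat x + mat y ** contrm"

lemma Rmat_mult_nth: "(Rmat x y ** M) $ (i, k) $ q = x * M $ (i, k) $ q + y * M $ (k, i) $ q"
  unfolding Rmat_def matrix_add_rdistrib matrix_mul_assoc[symmetric]
  by (simp add: mat_mult_nth swapm_mult_nth)

lemma mult_Rmat_nth:
  assumes "central x" "central y"
  shows "(M ** Rmat x y) $ p $ (j, l) = x * M $ p $ (j, l) + y * M $ p $ (l, j)"
proof -
  have "M ** Rmat x y = mat x ** M + mat y ** (M ** swapm)"
    by (simp only: Rmat_def matrix_add_ldistrib matrix_mul_assoc central_mat[OF assms(1), of M]
      central_mat[OF assms(2), of M])
  then show ?thesis
    by (simp add: mat_mult_nth mult_swapm_nth)
qed

text \<open>The form pairing \<open>i\<close> with \<open>- i\<close> is symmetric, so exchanging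
  the tensor factors on either side of \<open>contrm\<close> gives the same matrix; hence
  \<open>swapm\<close> and \<open>contrm\<close> commute.\<close>

lemma Rmat_Rtmat_commute:
  assumes "central x" "central y" "central z" "central w"
  shows "Rmat x y ** Rtmat z w = Rtmat z w ** Rmat x y"
proof -
  have "Rtmat z w $ (i, k) $ (j, l) = (if i = j \<and> k = l then z else 0) + w * contrm $ (i, k) $ (j, l)"
    for i j k l
    by (simp add: Rtmat_def mat_mult_nth) (simp add: mat_def)
  moreover have "contrm $ (k, i) $ (j, l) = (contrm $ (i, k) $ (l, j) :: 'a)" for i j k l
    by (auto simp: contrm_def eq_uminus_idx)
  ultimately show ?thesis
    by (auto simp: vec_eq_iff Rmat_mult_nth mult_Rmat_nth assms)
qed

lemma fst_Rtmat_snd_nth: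
  assumes "central z" "central w"
  shows "(fst_leg A ** Rtmat z w ** snd_leg B) $ (i, k) $ (j, l) =
    z * (A i j * B k l) + w * (A i (- k) * B (- j) l)"
proof -
  have "fst_leg A ** Rtmat z w ** snd_leg B =
      mat z ** (fst_leg A ** snd_leg B) + mat w ** (fst_leg A ** contrm ** snd_leg B)"
    by (simp only: Rtmat_def matrix_add_ldistrib matrix_add_rdistrib matrix_mul_assoc
        central_mat[OF assms(1), of "fst_leg A"] central_mat[OF assms(2), of "fst_leg A"])
  then show ?thesis
    by (simp add: mat_mult_nth fst_snd_leg_nth fst_contrm_snd_nth)
qed

lemma snd_Rtmat_fst_nth:
  assumes "central z" "central w"
  shows "(snd_leg B ** Rtmat z w ** fst_leg A) $ (i, k) $ (j, l) =
    z * (B k l * A i j) + w * (B k (- i) * A (- l) j)"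
proof -
  have "snd_leg B ** Rtmat z w ** fst_leg A =
      mat z ** (snd_leg B ** fst_leg A) + mat w ** (snd_leg B ** contrm ** fst_leg A)"
    by (simp only: Rtmat_def matrix_add_ldistrib matrix_add_rdistrib matrix_mul_assoc
        central_mat[OF assms(1), of "snd_leg B"] central_mat[OF assms(2), of "snd_leg B"])
  then show ?thesis
    by (simp add: mat_mult_nth snd_fst_leg_nth snd_contrm_fst_nth)
qed

text \<open>Since \<open>A2\<close> commutes with \<open>B1\<close> and \<open>A1\<close> with
  \<open>B2\<close>, the product regroups into the pair of \<open>A\<close> and the pair of
  \<open>B\<close>, and \<open>R\<close> passes one pair after the other. This is what makes tensor
  products of RTT modules possible.\<close>

lemma RTT_product:
  fixes R A1 A2 B1 B2 :: "'a::semiring_1 ^ 'n::finite ^ 'n"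
  assumes "R ** (A1 ** A2) = A2 ** A1 ** R" "R ** (B1 ** B2) = B2 ** B1 ** R"
    and "A2 ** B1 = B1 ** A2" "A1 ** B2 = B2 ** A1"
  shows "R ** ((A1 ** B1) ** (A2 ** B2)) = (A2 ** B2) ** (A1 ** B1) ** R"
proof -
  have "R ** ((A1 ** B1) ** (A2 ** B2)) = R ** (A1 ** (A2 ** B1) ** B2)"
    unfolding assms(3) by (simp only: matrix_mul_assoc)
  also have "\<dots> = R ** (A1 ** A2) ** (B1 ** B2)"
    by (simp only: matrix_mul_assoc)
  also have "\<dots> = A2 ** A1 ** (R ** (B1 ** B2))"
    unfolding assms(1) by (simp only: matrix_mul_assoc)
  also have "\<dots> = A2 ** (A1 ** B2) ** B1 ** R"
    unfolding assms(2) by (simp only: matrix_mul_assoc)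
  also have "\<dots> = (A2 ** B2) ** (A1 ** B1) ** R"
    unfolding assms(4) by (simp only: matrix_mul_assoc)
  finally show ?thesis .
qed

text \<open>The mixed relations bring the two \<open>U\<close> legs together on one side and the two
  \<open>T\<close> legs on the other; \<open>R\<close> then passes the \<open>U\<close> legs,
  \<open>R'\<close> and the \<open>T\<close> legs in turn. With \<open>U = \<eta>(T)\<close> the
  product \<open>U T\<close> is \<open>S\<close>.\<close>

lemma reflection_product:
  fixes R R' U1 U2 T1 T2 :: "'a::semiring_1 ^ 'n::finite ^ 'n"
  assumes U: "R ** (U1 ** U2) = U2 ** U1 ** R" and T: "R ** (T1 ** T2) = T2 ** T1 ** R"
    and TU: "T1 ** R' ** U2 = U2 ** R' ** T1" and UT: "U1 ** R' ** T2 = T2 ** R' ** U1"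
    and R: "R ** R' = R' ** R"
  shows "R ** ((U1 ** T1) ** R' ** (U2 ** T2)) = (U2 ** T2) ** R' ** (U1 ** T1) ** R"
proof -
  have "R ** ((U1 ** T1) ** R' ** (U2 ** T2)) = R ** (U1 ** (T1 ** R' ** U2) ** T2)"
    by (simp only: matrix_mul_assoc)
  also have "\<dots> = R ** (U1 ** U2) ** R' ** (T1 ** T2)"
    unfolding TU by (simp only: matrix_mul_assoc)
  also have "\<dots> = U2 ** U1 ** (R ** R') ** (T1 ** T2)"
    unfolding U by (simp only: matrix_mul_assoc)
  also have "\<dots> = U2 ** U1 ** R' ** (R ** (T1 ** T2))"
    unfolding R by (simp only: matrix_mul_assoc)
  also have "\<dots> = U2 ** (U1 ** R' ** T2) ** T1 ** R"
    unfolding T by (simp only: matrix_mul_assoc)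
  also have "\<dots> = (U2 ** T2) ** R' ** (U1 ** T1) ** R"
    unfolding UT by (simp only: matrix_mul_assoc)
  finally show ?thesis .
qed

section \<open>Series in two variables\<close>

notation fps_nth (infixl "$$" 75)

text \<open>Double series have \<open>u^-1\<close> as outer variable \<open>fps_X\<close> and
  \<open>v^-1\<close> as inner variable \<open>fps_Y\<close>: \<open>F $$ m $$ n\<close> is the
  coefficient of \<open>u^-m v^-n\<close>. Thus \<open>fst_ser\<close> depends on \<open>u\<close>
  only and \<open>snd_ser\<close> on \<open>v\<close> only.\<close>

definition fst_ser :: "(nat \<Rightarrow> 'a) \<Rightarrow> 'a::ring_1 fps fps" where
  "fst_ser f = Abs_fps (\<lambda>m. fps_const (f m))"

definition snd_ser :: "(nat \<Rightarrow> 'a) \<Rightarrow> 'a::ring_1 fps fps" where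
  "snd_ser f = fps_const (Abs_fps f)"

abbreviation fps_Y :: "'a::ring_1 fps fps" where
  "fps_Y \<equiv> fps_const fps_X"

lemma fst_snd_ser_nth: "(fst_ser f * snd_ser g) $$ m $$ n = f m * g n"
  by (simp add: fst_ser_def snd_ser_def)

lemma snd_fst_ser_nth: "(snd_ser g * fst_ser f) $$ m $$ n = g n * f m"
  by (simp add: fst_ser_def snd_ser_def)

lemma central_fps_X: "central (fps_X :: 'a::ring_1 fps)"
  unfolding central_def by (intro allI fps_mult_fps_X_commute)

lemma central_fps_const: "central c \<Longrightarrow> central (fps_const c)"
  by (simp add: central_def fps_eq_iff)

lemma central_mult: "central x \<Longrightarrow> central y \<Longrightarrow> central (x * y)"
  unfolding central_def by (metis mult.assoc)

lemma central_add:
  "central x \<Longrightarrow> central y \<Longrightarrow> central (x + y)" "central x \<Longrightarrow> central y \<Longrightarrow> central (x - y)"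
  "central x \<Longrightarrow> central (- x)"
  unfolding central_def
  by (simp_all add: distrib_left distrib_right left_diff_distrib right_diff_distrib)

lemma fst_ser_mult: "fst_ser f * fst_ser g = fst_ser (\<lambda>r. \<Sum>a\<le>r. f a * g (r - a))"
  by (simp add: fst_ser_def fps_eq_iff fps_mult_nth atMost_atLeast0 fps_sum_nth)

lemma snd_ser_mult: "snd_ser f * snd_ser g = snd_ser (\<lambda>r. \<Sum>a\<le>r. f a * g (r - a))"
  by (simp add: snd_ser_def fps_eq_iff fps_mult_nth atMost_atLeast0)

lemma fst_ser_sum: "sum (\<lambda>k. fst_ser (f k)) S = fst_ser (\<lambda>r. \<Sum>k\<in>S. f k r)"
  by (induction S rule: infinite_finite_induct) (simp_all add: fst_ser_def fps_eq_iff)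

lemma snd_ser_sum: "sum (\<lambda>k. snd_ser (f k)) S = snd_ser (\<lambda>r. \<Sum>k\<in>S. f k r)"
  by (induction S rule: infinite_finite_induct) (simp_all add: snd_ser_def fps_eq_iff)

section \<open>The RTT relation\<close>

text \<open>The Yangian relation multiplied by \<open>u - v\<close>, at \<open>u^-r v^-s\<close>.
  The sum from expanding \<open>1 / (u - v)\<close> thereby becomes a recursion.\<close>

definition rtt :: "(idx \<Rightarrow> idx \<Rightarrow> nat \<Rightarrow> 'a::ring_1) \<Rightarrow> bool" where
  "rtt A \<longleftrightarrow> (\<forall>i j. A i j 0 = of_bool (i = j)) \<and>
    (\<forall>i j k l r s. (A i j (Suc r) * A k l s - A k l s * A i j (Suc r)) -
        (A i j r * A k l (Suc s) - A k l (Suc s) * A i j r) =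
      A k j r * A i l s - A k j s * A i l r)"

abbreviation leg1 :: "(idx \<Rightarrow> idx \<Rightarrow> nat \<Rightarrow> 'a::ring_1) \<Rightarrow> 'a fps fps mat2" where
  "leg1 A \<equiv> fst_leg (\<lambda>i j. fst_ser (A i j))"

abbreviation leg2 :: "(idx \<Rightarrow> idx \<Rightarrow> nat \<Rightarrow> 'a::ring_1) \<Rightarrow> 'a fps fps mat2" where
  "leg2 A \<equiv> snd_leg (\<lambda>i j. snd_ser (A i j))"

text \<open>Clearing denominators: this is \<open>u^-1 v^-1 (u - v - P)\<close>, and
  \<open>Rtser\<close> is \<open>u^-1 v^-1 (u + v + Q)\<close>.\<close>

abbreviation Rser :: "'a::ring_1 fps fps mat2" where
  "Rser \<equiv> Rmat (fps_Y - fps_X) (- (fps_X * fps_Y))"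

abbreviation Rtser :: "'a::ring_1 fps fps mat2" where
  "Rtser \<equiv> Rtmat (fps_X + fps_Y) (fps_X * fps_Y)"

lemma central_fps_Y: "central (fps_Y :: 'a::ring_1 fps fps)"
  by (intro central_fps_const central_fps_X)

lemmas central_ser = central_add central_mult central_fps_X central_fps_Y

lemma Rser_leg1_leg2_nth:
  "(Rser ** (leg1 A ** leg2 B)) $ (i, k) $ (j, l) $$ m $$ n =
    (if n = 0 then 0 else A i j m * B k l (n - 1)) - (if m = 0 then 0 else A i j (m - 1) * B k l n) -
    (if m = 0 \<or> n = 0 then 0 else A k j (m - 1) * B i l (n - 1))"
  by (simp add: Rmat_mult_nth fst_snd_leg_nth left_diff_distrib mult.assoc fst_ser_def snd_ser_def)

lemma leg2_leg1_Rser_nth: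
  "((leg2 B ** leg1 A) ** Rser) $ (i, k) $ (j, l) $$ m $$ n =
    (if n = 0 then 0 else B k l (n - 1) * A i j m) - (if m = 0 then 0 else B k l n * A i j (m - 1)) -
    (if m = 0 \<or> n = 0 then 0 else B k j (n - 1) * A i l (m - 1))"
  by (simp add: mult_Rmat_nth central_ser snd_fst_leg_nth left_diff_distrib mult.assoc fst_ser_def snd_ser_def)

text \<open>At \<open>u^-m v^-n\<close> with \<open>m, n > 0\<close> the entries of the matrix
  identity are the relations of \<open>rtt\<close> for \<open>m - 1\<close> and
  \<open>n - 1\<close>. If \<open>m\<close> or \<open>n\<close> is 0, they hold because the constant
  term is the identity.\<close>

lemma rtt_iff:
  assumes "\<And>i j. A i j 0 = of_bool (i = j)"
  shows "rtt A \<longleftrightarrow> Rser ** (leg1 A ** leg2 A) = leg2 A ** leg1 A ** Rser"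
proof
  assume A: "rtt A"
  show "Rser ** (leg1 A ** leg2 A) = leg2 A ** leg1 A ** Rser"
  proof (simp only: vec_eq_iff fps_eq_iff split_paired_All, intro allI)
    fix i k j l m n
    have "m > 0 \<Longrightarrow> n > 0 \<Longrightarrow> (A i j m * A k l (n - 1) - A k l (n - 1) * A i j m) -
        (A i j (m - 1) * A k l n - A k l n * A i j (m - 1)) =
      A k j (m - 1) * A i l (n - 1) - A k j (n - 1) * A i l (m - 1)"
      using A unfolding rtt_def by (metis Suc_pred' One_nat_def)
    then show "(Rser ** (leg1 A ** leg2 A)) $ (i, k) $ (j, l) $$ m $$ n =
        (leg2 A ** leg1 A ** Rser) $ (i, k) $ (j, l) $$ m $$ n"
      by (auto simp: Rser_leg1_leg2_nth leg2_leg1_Rser_nth assms algebra_simps)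
  qed
next
  assume *: "Rser ** (leg1 A ** leg2 A) = leg2 A ** leg1 A ** Rser"
  show "rtt A"
    unfolding rtt_def
  proof (intro conjI allI assms)
    fix i j k l r s
    have "(Rser ** (leg1 A ** leg2 A)) $ (i, k) $ (j, l) $$ Suc r $$ Suc s =
        (leg2 A ** leg1 A ** Rser) $ (i, k) $ (j, l) $$ Suc r $$ Suc s"
      by (simp only: *)
    then show "(A i j (Suc r) * A k l s - A k l s * A i j (Suc r)) -
        (A i j r * A k l (Suc s) - A k l (Suc s) * A i j r) =
      A k j r * A i l s - A k j s * A i l r"
      by (simp add: Rser_leg1_leg2_nth leg2_leg1_Rser_nth algebra_simps)
  qed
qed

lemma leg1_Rtser_leg2_nth:
  "(leg1 A ** Rtser ** leg2 B) $ (i, k) $ (j, l) $$ m $$ n =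
    (if m = 0 then 0 else A i j (m - 1) * B k l n) + (if n = 0 then 0 else A i j m * B k l (n - 1)) +
    (if m = 0 \<or> n = 0 then 0 else A i (- k) (m - 1) * B (- j) l (n - 1))"
  by (simp add: fst_Rtmat_snd_nth central_ser distrib_right mult.assoc fst_ser_def snd_ser_def)

lemma leg2_Rtser_leg1_nth:
  "(leg2 B ** Rtser ** leg1 A) $ (i, k) $ (j, l) $$ m $$ n =
    (if m = 0 then 0 else B k l n * A i j (m - 1)) + (if n = 0 then 0 else B k l (n - 1) * A i j m) +
    (if m = 0 \<or> n = 0 then 0 else B k (- i) (n - 1) * A (- l) j (m - 1))"
  by (simp add: snd_Rtmat_fst_nth central_ser distrib_right mult.assoc fst_ser_def snd_ser_def)

text \<open>The second identity is the hypothesis read with the legs, and hence \<open>u\<close> and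
  \<open>v\<close>, exchanged.\<close>

lemma mixed_imp_mat:
  assumes A: "\<And>i j. A i j 0 = of_bool (i = j)" and B: "\<And>i j. B i j 0 = of_bool (i = j)"
    and *: "\<And>i j k l r s. (A i j (Suc r) * B k l s - B k l s * A i j (Suc r)) +
      (A i j r * B k l (Suc s) - B k l (Suc s) * A i j r) =
      B k (- i) s * A (- l) j r - A i (- k) r * B (- j) l s"
  shows "leg1 A ** Rtser ** leg2 B = leg2 B ** Rtser ** leg1 A"
    and "leg1 B ** Rtser ** leg2 A = leg2 A ** Rtser ** leg1 B"
proof -
  have **: "(A i j m * B k l (n - 1) - B k l (n - 1) * A i j m) +
      (A i j (m - 1) * B k l n - B k l n * A i j (m - 1)) =
      B k (- i) (n - 1) * A (- l) j (m - 1) - A i (- k) (m - 1) * B (- j) l (n - 1)"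
    if "m > 0" "n > 0" for i j k l m n
    using *[of i j "m - 1" k l "n - 1"] that by simp
  show "leg1 A ** Rtser ** leg2 B = leg2 B ** Rtser ** leg1 A"
    using ** by (auto simp: vec_eq_iff fps_eq_iff leg1_Rtser_leg2_nth leg2_Rtser_leg1_nth A B algebra_simps)
  show "leg1 B ** Rtser ** leg2 A = leg2 A ** Rtser ** leg1 B"
    using **[of n m k l i j for k l n i j m]
    by (auto simp: vec_eq_iff fps_eq_iff leg1_Rtser_leg2_nth leg2_Rtser_leg1_nth A B algebra_simps)
qed

definition conv :: "(idx \<Rightarrow> idx \<Rightarrow> nat \<Rightarrow> 'a) \<Rightarrow> (idx \<Rightarrow> idx \<Rightarrow> nat \<Rightarrow> 'a) \<Rightarrow> idx \<Rightarrow> idx \<Rightarrow> nat \<Rightarrow> 'a::ring_1"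
  where "conv A B i j r = (\<Sum>k\<in>UNIV. \<Sum>a\<le>r. A i k a * B k j (r - a))"

lemma leg_mult: "leg1 A ** leg1 B = leg1 (conv A B)" "leg2 A ** leg2 B = leg2 (conv A B)"
  by (simp_all add: fst_fst_leg snd_snd_leg fst_ser_mult snd_ser_mult fst_ser_sum snd_ser_sum
    conv_def[abs_def])

lemma conv_0: "conv A B i j 0 = (\<Sum>k\<in>UNIV. A i k 0 * B k j 0)"
  by (simp add: conv_def)

section \<open>Relations of the twisted Yangian\<close>

text \<open>The commutator sums for \<open>(Suc r, s)\<close> and \<open>(r, Suc s)\<close> differ
  only by the term \<open>a = 0\<close> of the first.\<close>

lemma rtt_yT: "rtt yT"
  unfolding rtt_def
proof (intro conjI allI yT_0)
  fix i j k l r s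
  show "(yT i j (Suc r) * yT k l s - yT k l s * yT i j (Suc r)) -
        (yT i j r * yT k l (Suc s) - yT k l (Suc s) * yT i j r) =
      yT k j r * yT i l s - yT k j s * yT i l r"
    unfolding yT_commutator sum.lessThan_Suc_shift by simp
qed

text \<open>By \<open>eta_T\<close> these are the coefficients of
  \<open>\<eta>(T(u))\<close>.\<close>

definition yU :: "idx \<Rightarrow> idx \<Rightarrow> nat \<Rightarrow> yangian3" where
  "yU i j r = (- 1) ^ r * yT (- j) (- i) r"

lemma yU_0: "yU i j 0 = of_bool (i = j)"
  by (auto simp: yU_def yT_0)

lemma eta_uminus: "eta (- x) = - eta x"
  using eta_add[of x "- x"] eta_add[of 0 0] by (simp add: add_eq_0_iff)

lemma eta_diff: "eta (x - y) = eta x - eta y"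
  using eta_add[of x "- y"] by (simp add: eta_uminus)

lemma rtt_yU: "rtt yU"
  unfolding rtt_def
proof (intro conjI allI yU_0)
  fix i j k l r s
  have "eta ((yT i j (Suc r) * yT k l s - yT k l s * yT i j (Suc r)) -
        (yT i j r * yT k l (Suc s) - yT k l (Suc s) * yT i j r)) =
      eta (yT k j r * yT i l s - yT k j s * yT i l r)"
    using rtt_yT unfolding rtt_def by simp
  then show "(yU i j (Suc r) * yU k l s - yU k l s * yU i j (Suc r)) -
        (yU i j r * yU k l (Suc s) - yU k l (Suc s) * yU i j r) =
      yU k j r * yU i l s - yU k j s * yU i l r"
    unfolding eta_diff eta_mult eta_T yU_def[symmetric] .
qed

text \<open>The RTT relation between \<open>yT (- l) (- k)\<close> and \<open>yT i j\<close> with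
  \<open>- v\<close> in place of \<open>v\<close>: the sign \<open>(- 1) ^ s\<close> in
  \<open>yU\<close> turns the difference of commutators into a sum.\<close>

lemma yT_yU_mixed:
  "(yT i j (Suc r) * yU k l s - yU k l s * yT i j (Suc r)) +
      (yT i j r * yU k l (Suc s) - yU k l (Suc s) * yT i j r) =
      yU k (- i) s * yT (- l) j r - yT i (- k) r * yU (- j) l s"
proof -
  have "(yT (- l) (- k) (Suc s) * yT i j r - yT i j r * yT (- l) (- k) (Suc s)) -
        (yT (- l) (- k) s * yT i j (Suc r) - yT i j (Suc r) * yT (- l) (- k) s) =
      yT i (- k) s * yT (- l) j r - yT i (- k) r * yT (- l) j s"
    using rtt_yT unfolding rtt_def by blast
  then show ?thesis
    by (cases "even s") (auto simp: yU_def algebra_simps)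
qed

definition yS :: "idx \<Rightarrow> idx \<Rightarrow> nat \<Rightarrow> yangian3" where
  "yS = conv yU yT"

lemma Sser_eq: "Sser i j = Abs_fps (yS i j)"
  by (simp add: fps_eq_iff Sser_def yS_def conv_def fps_sum_nth fps_mult_nth Tser_def eta_T yU_def atMost_atLeast0)

lemma reflection_equation:
  "Rser ** (leg1 yS ** Rtser ** leg2 yS) = leg2 yS ** Rtser ** leg1 yS ** Rser"
proof -
  have S: "leg1 yU ** leg1 yT = leg1 yS" "leg2 yU ** leg2 yT = leg2 yS"
    by (simp_all add: leg_mult yS_def)
  show ?thesis
    unfolding S[symmetric]
    by (intro reflection_product Rmat_Rtmat_commute central_ser mixed_imp_mat yT_yU_mixed yT_0 yU_0
      rtt_iff[THEN iffD1] rtt_yT rtt_yU)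
qed

section \<open>The symmetry relation of S\<close>

lemma sign_mult_cancel: "(- 1 :: 'a::ring_1) ^ r * ((- 1) ^ a * x) = (- 1) ^ (r - a) * x" if "a \<le> r"
  using that by (cases "even r"; cases "even a") simp_all

lemma sum_atMost_rev: "(\<Sum>s\<le>n. f s) = (\<Sum>s\<le>n. f (n - s))"
  for f :: "nat \<Rightarrow> 'a::comm_monoid_add"
  using sum.atLeastAtMost_rev[of f 0 n] by (simp add: atMost_atLeast0)

text \<open>Passing to \<open>S_{-j,-i}(-u)\<close> exchanges the roles of \<open>yT\<close> and
  \<open>yU\<close>, so the product defining \<open>S_{i,j}(u)\<close> reappears with its factors
  reversed.\<close>

lemma yS_uminus:
  "(- 1) ^ r * yS (- j) (- i) r = (\<Sum>k\<in>UNIV. \<Sum>a\<le>r. yT k j a * yU i k (r - a))"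
proof -
  have "(- 1) ^ r * yS (- j) (- i) r =
      (\<Sum>k\<in>UNIV. \<Sum>a\<le>r. (- 1) ^ r * (yU (- j) (- k) a * yT (- k) (- i) (r - a)))"
    unfolding yS_def conv_def by (subst sum_uminus_idx[symmetric]) (simp add: sum_distrib_left)
  also have "\<dots> = (\<Sum>k\<in>UNIV. \<Sum>a\<le>r. yT k j a * yU i k (r - a))"
  proof (intro sum.cong refl)
    fix k a assume "a \<in> {..r}"
    then have "(- 1) ^ r * (yU (- j) (- k) a * yT (- k) (- i) (r - a)) =
        (- 1) ^ (r - a) * (yT k j a * yT (- k) (- i) (r - a))"
      by (simp add: yU_def mult.assoc sign_mult_cancel)
    also have "\<dots> = yT k j a * yU i k (r - a)"
      by (cases "even (r - a)") (simp_all only: yU_def minus_one_power_iff, simp_all)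
    finally show "(- 1) ^ r * (yU (- j) (- k) a * yT (- k) (- i) (r - a)) = yT k j a * yU i k (r - a)" .
  qed
  finally show ?thesis .
qed

text \<open>In series form,
  \<open>2u (S_{-j,-i}(-u) - S_{i,j}(u)) = S_{i,j}(u) - S_{i,j}(-u)\<close>. By
  \<open>yS_uminus\<close> the difference on the left consists of commutators of \<open>yT\<close>
  with \<open>yU\<close>, to which the mixed relation applies.\<close>

lemma yS_symmetry:
  "2 * ((- 1) ^ Suc n * yS (- j) (- i) (Suc n) - yS i j (Suc n)) = yS i j n - (- 1) ^ n * yS i j n"
proof -
  define c where "c k a s = yT k j a * yU i k s - yU i k s * yT k j a" for k a s
  have S: "yS i j r = (\<Sum>k\<in>UNIV. \<Sum>a\<le>r. yU i k (r - a) * yT k j a)" for i j r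
    unfolding yS_def conv_def
    by (rule sum.cong[OF refl], subst sum_atMost_rev) simp
  have "(- 1) ^ Suc n * yS (- j) (- i) (Suc n) - yS i j (Suc n) =
      (\<Sum>k\<in>UNIV. \<Sum>a\<le>Suc n. c k a (Suc n - a))"
    unfolding yS_uminus S[of i j] c_def by (simp only: sum_subtractf)
  \<comment> \<open>Commutators with a coefficient of index 0 vanish. Dropping the first or the last
    term writes the same sum in two ways, whose total is the left side of
    \<open>yT_yU_mixed\<close>.\<close>
  moreover have "(\<Sum>a\<le>Suc n. c k a (Suc n - a)) = (\<Sum>a\<le>n. c k (Suc a) (n - a))" for k
    unfolding sum.atMost_Suc_shift by (simp add: c_def yT_0)
  moreover have "(\<Sum>a\<le>Suc n. c k a (Suc n - a)) = (\<Sum>a\<le>n. c k a (Suc (n - a)))" for k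
    by (simp add: c_def yU_0 Suc_diff_le)
  ultimately have "(- 1) ^ Suc n * yS (- j) (- i) (Suc n) - yS i j (Suc n) =
        (\<Sum>k\<in>UNIV. \<Sum>a\<le>n. c k (Suc a) (n - a))"
      "(- 1) ^ Suc n * yS (- j) (- i) (Suc n) - yS i j (Suc n) =
        (\<Sum>k\<in>UNIV. \<Sum>a\<le>n. c k a (Suc (n - a)))"
    by simp_all
  then have "2 * ((- 1) ^ Suc n * yS (- j) (- i) (Suc n) - yS i j (Suc n)) =
      (\<Sum>k\<in>UNIV. \<Sum>a\<le>n. c k (Suc a) (n - a) + c k a (Suc (n - a)))"
    unfolding mult_2 sum.distrib by argo
  also have "\<dots> = (\<Sum>k\<in>UNIV. \<Sum>a\<le>n. yU i (- k) (n - a) * yT (- k) j a - yT k (- i) a * yU (- j) k (n - a))"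
    unfolding c_def yT_yU_mixed ..
  also have "\<dots> = (\<Sum>k\<in>UNIV. \<Sum>a\<le>n. yU i (- k) (n - a) * yT (- k) j a) -
      (\<Sum>k\<in>UNIV. \<Sum>a\<le>n. yT k (- i) a * yU (- j) k (n - a))"
    by (simp only: sum_subtractf)
  also have "(\<Sum>k\<in>UNIV. \<Sum>a\<le>n. yT k (- i) a * yU (- j) k (n - a)) = (- 1) ^ n * yS i j n"
    using yS_uminus[of n "- i" "- j"] by simp
  also have "(\<Sum>k\<in>UNIV. \<Sum>a\<le>n. yU i (- k) (n - a) * yT (- k) j a) = yS i j n"
    using sum_uminus_idx[of "\<lambda>k. \<Sum>a\<le>n. yU i k (n - a) * yT k j a"] by (simp only: S)
  finally show ?thesis .
qed

section \<open>The weight filtration\<close>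

text \<open>Step \<open>d\<close> of the filtration that puts \<open>yS i j r\<close> in weight
  \<open>r\<close>, as a closure under the algebra operations.\<close>

inductive fil :: "nat \<Rightarrow> yangian3 \<Rightarrow> bool" where
  fil_one: "fil 0 1"
| fil_yS: "fil r (yS i j r)"
| fil_add: "fil d x \<Longrightarrow> fil d y \<Longrightarrow> fil d (x + y)"
| fil_scale: "fil d x \<Longrightarrow> fil d (yscale c x)"
| fil_mult: "fil d x \<Longrightarrow> fil e y \<Longrightarrow> fil (d + e) (x * y)"
| fil_mono: "fil d x \<Longrightarrow> d \<le> e \<Longrightarrow> fil e x"

lemma fil_zero: "fil d 0"
  using fil_mono[OF fil_scale[OF fil_one, of 0], of d] by simp

lemma fil_uminus: "fil d x \<Longrightarrow> fil d (- x)"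
  using fil_scale[of d x "- 1"] by simp

lemma fil_diff: "fil d x \<Longrightarrow> fil d y \<Longrightarrow> fil d (x - y)"
  using fil_add[of d x "- y"] fil_uminus[of d y] by simp

lemma fil_sum: "(\<And>a. a \<in> A \<Longrightarrow> fil d (f a)) \<Longrightarrow> fil d (sum f A)"
  by (induction A rule: infinite_finite_induct) (auto intro: fil_zero fil_add)

lemma fil_mult_le: "fil a x \<Longrightarrow> fil b y \<Longrightarrow> a + b \<le> d \<Longrightarrow> fil d (x * y)"
  using fil_mult fil_mono by blast

text \<open>\<open>low d\<close> is the filtration step strictly below weight \<open>d\<close>; it avoids truncated subtraction
  at \<open>d = 0\<close>.\<close>

fun low :: "nat \<Rightarrow> yangian3 \<Rightarrow> bool" where
  "low 0 x \<longleftrightarrow> x = 0"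
| "low (Suc d) x \<longleftrightarrow> fil d x"

lemma low_zero: "low d 0"
  by (cases d) (auto intro: fil_zero)

lemma low_add: "low d x \<Longrightarrow> low d y \<Longrightarrow> low d (x + y)"
  by (cases d) (auto intro: fil_add)

lemma low_uminus: "low d x \<Longrightarrow> low d (- x)"
  by (cases d) (auto intro: fil_uminus)

lemma low_scale: "low d x \<Longrightarrow> low d (yscale c x)"
  by (cases d) (auto intro: fil_scale)

lemma low_mono: "low d x \<Longrightarrow> d \<le> e \<Longrightarrow> low e x"
  by (cases d; cases e) (auto intro: fil_mono fil_zero)

lemma low_mult_right: "fil a x \<Longrightarrow> low b y \<Longrightarrow> low (a + b) (x * y)"
  by (cases b) (auto intro: fil_mult low_zero)

lemma low_mult_left: "fil a x \<Longrightarrow> low b y \<Longrightarrow> low (b + a) (y * x)"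
  by (cases b) (auto intro: fil_mult low_zero)

section \<open>Commutators lower the weight\<close>

lemma yS_0: "yS i j 0 = of_bool (i = j)"
  by (simp add: yS_def conv_def yU_0 yT_0)

text \<open>The scalar parts of \<open>Rser\<close> and \<open>Rtser\<close> multiply to
  \<open>v^-2 - u^-2\<close>. At \<open>u^-1 v^-(b+2)\<close> only \<open>v^-2\<close> contributes,
  leaving a single commutator; the other terms come from \<open>swapm\<close> and
  \<open>contrm\<close>.\<close>

lemma yS_commutator_1:
  "yS i j 1 * yS k l b - yS k l b * yS i j 1 =
    yS k j 0 * yS i l b - yS i (- k) 0 * yS (- j) l b +
    yS k (- i) b * yS (- l) j 0 - yS k j b * yS i l 0"
proof -
  have "(Rser ** (leg1 yS ** Rtser ** leg2 yS)) $ (i, k) $ (j, l) $$ 1 $$ Suc (Suc b) =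
      (leg2 yS ** Rtser ** leg1 yS ** Rser) $ (i, k) $ (j, l) $$ 1 $$ Suc (Suc b)"
    by (simp only: reflection_equation)
  then show ?thesis
    by (simp add: Rmat_mult_nth mult_Rmat_nth central_ser left_diff_distrib mult.assoc
        leg1_Rtser_leg2_nth leg2_Rtser_leg1_nth) (simp add: algebra_simps)
qed

text \<open>Here both terms of \<open>v^-2 - u^-2\<close> contribute. The first superscript is
  traded for one smaller by 2, the second grows by 2, and the remaining products have total
  superscript at most \<open>a + b + 1\<close>.\<close>

lemma yS_commutator_Suc_Suc:
  "(yS i j (Suc (Suc a)) * yS k l b - yS k l b * yS i j (Suc (Suc a))) =
   (yS i j a * yS k l (Suc (Suc b)) - yS k l (Suc (Suc b)) * yS i j a) +
   (yS i (- k) a * yS (- j) l (Suc b) - yS i (- k) (Suc a) * yS (- j) l b +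
    yS k j a * yS i l (Suc b) + yS k j (Suc a) * yS i l b + yS k (- i) a * yS (- j) l b +
    yS k (- i) b * yS (- l) j (Suc a) - yS k (- i) (Suc b) * yS (- l) j a -
    yS k j (Suc b) * yS i l a - yS k j b * yS i l (Suc a) - yS k (- i) b * yS (- j) l a)"
proof -
  have "(Rser ** (leg1 yS ** Rtser ** leg2 yS)) $ (i, k) $ (j, l) $$ Suc (Suc a) $$ Suc (Suc b) =
      (leg2 yS ** Rtser ** leg1 yS ** Rser) $ (i, k) $ (j, l) $$ Suc (Suc a) $$ Suc (Suc b)"
    by (simp only: reflection_equation)
  then show ?thesis
    by (simp add: Rmat_mult_nth mult_Rmat_nth central_ser left_diff_distrib mult.assoc
        leg1_Rtser_leg2_nth leg2_Rtser_leg1_nth) (simp add: algebra_simps)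
qed

text \<open>Induction on \<open>a\<close> in steps of 2 down to 0 or 1, with \<open>b\<close>
  arbitrary because it grows meanwhile.\<close>

lemma low_yS_commutator: "low (a + b) (yS i j a * yS k l b - yS k l b * yS i j a)"
proof (induction a arbitrary: b rule: less_induct)
  case (less a)
  show ?case
  proof (cases a)
    case 0
    then show ?thesis by (simp add: yS_0 low_zero)
  next
    case (Suc a')
    show ?thesis
    proof (cases a')
      case 0
      have "fil b (yS i j 1 * yS k l b - yS k l b * yS i j 1)"
        unfolding yS_commutator_1 by (intro fil_add fil_diff fil_mult_le[OF fil_yS fil_yS]) simp_all
      then show ?thesis using Suc 0 by simp
    next
      case (Suc a'')
      with \<open>a = Suc a'\<close> have a: "a = Suc (Suc a'')" by simp
      have *: "fil (Suc a'' + b) (yS i j a'' * yS k l (Suc (Suc b)) - yS k l (Suc (Suc b)) * yS i j a'')"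
        using less[of a'' "Suc (Suc b)"] a by simp
      have "fil (Suc a'' + b) (yS i j a * yS k l b - yS k l b * yS i j a)"
        unfolding a yS_commutator_Suc_Suc
        by (intro fil_add[OF *] fil_add fil_diff fil_mult_le[OF fil_yS fil_yS]) simp_all
      then show ?thesis using a by simp
    qed
  qed
qed

lemma low_commutator_yS:
  assumes "fil b y"
  shows "low (a + b) (yS i j a * y - y * yS i j a)"
  using assms
proof (induction rule: fil.induct)
  case fil_one
  then show ?case by (simp add: low_zero)
next
  case (fil_yS r k l)
  then show ?case by (rule low_yS_commutator)
next
  case (fil_add d x y)
  have "yS i j a * (x + y) - (x + y) * yS i j a =
      (yS i j a * x - x * yS i j a) + (yS i j a * y - y * yS i j a)"
    by (simp add: algebra_simps)
  with fil_add low_add show ?case by presburger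
next
  case (fil_scale d x c)
  have "yS i j a * yscale c x - yscale c x * yS i j a = yscale c (yS i j a * x - x * yS i j a)"
    by (simp add: yscale_mult_left yscale_mult_right Y.scale_right_diff_distrib)
  with fil_scale low_scale show ?case by presburger
next
  case (fil_mult d x e y)
  have "yS i j a * (x * y) - x * y * yS i j a =
      (yS i j a * x - x * yS i j a) * y + x * (yS i j a * y - y * yS i j a)"
    by (simp add: algebra_simps)
  moreover have "low (a + (d + e)) ((yS i j a * x - x * yS i j a) * y)"
    using low_mult_left[OF fil_mult.hyps(2) fil_mult.IH(1)] by (simp add: add_ac)
  moreover have "low (a + (d + e)) (x * (yS i j a * y - y * yS i j a))"
    using low_mult_right[OF fil_mult.hyps(1) fil_mult.IH(2)] by (simp add: add_ac)
  ultimately show ?case using low_add by presburger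
next
  case (fil_mono d x e)
  then show ?case using low_mono by (meson add_left_mono)
qed

text \<open>The associated graded algebra is commutative: a commutator is a derivation in each
  argument, so the bound passes from the generators to products.\<close>

lemma low_commutator:
  assumes "fil a x" "fil b y"
  shows "low (a + b) (x * y - y * x)"
  using assms(1)
proof (induction rule: fil.induct)
  case fil_one
  then show ?case by (simp add: low_zero)
next
  case (fil_yS r k l)
  then show ?case by (intro low_commutator_yS assms)
next
  case (fil_add d x x')
  have "(x + x') * y - y * (x + x') = (x * y - y * x) + (x' * y - y * x')"
    by (simp add: algebra_simps)
  with fil_add low_add show ?case by presburger
next
  case (fil_scale d x c)
  have "yscale c x * y - y * yscale c x = yscale c (x * y - y * x)"
    by (simp add: yscale_mult_left yscale_mult_right Y.scale_right_diff_distrib)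
  with fil_scale low_scale show ?case by presburger
next
  case (fil_mult d x e x')
  have "x * x' * y - y * (x * x') = (x * y - y * x) * x' + x * (x' * y - y * x')"
    by (simp add: algebra_simps)
  moreover have "low (d + e + b) ((x * y - y * x) * x')"
    using low_mult_left[OF fil_mult.hyps(2) fil_mult.IH(1)] by (simp add: add_ac)
  moreover have "low (d + e + b) (x * (x' * y - y * x'))"
    using low_mult_right[OF fil_mult.hyps(1) fil_mult.IH(2)] by (simp add: add_ac)
  ultimately show ?case using low_add by presburger
next
  case (fil_mono d x e)
  then show ?case using low_mono by (meson add_right_mono)
qed

section \<open>Inverting the matrix D\<close>

text \<open>Coefficients of the solution \<open>X\<close> of \<open>M ** X = mat 1\<close> when
  \<open>M\<close> has the identity as constant term: each order is solved for the newest
  coefficient of \<open>X\<close>.\<close>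

fun mat_rinv :: "('n::finite \<Rightarrow> 'n \<Rightarrow> nat \<Rightarrow> 'a::ring_1) \<Rightarrow> nat \<Rightarrow> 'n \<Rightarrow> 'n \<Rightarrow> 'a" where
  "mat_rinv M 0 i j = of_bool (i = j)"
| "mat_rinv M (Suc n) i j = - (\<Sum>s\<le>n. \<Sum>b\<in>UNIV. M i b (Suc n - s) * mat_rinv M s b j)"

declare mat_rinv.simps(2) [simp del]

lemma fps_matrix_right_inverse:
  fixes M :: "'a::ring_1 fps ^ 'n::finite ^ 'n"
  assumes "\<And>i j. M $ i $ j $$ 0 = of_bool (i = j)"
  obtains X where "M ** X = mat 1" "\<And>i j. X $ i $ j $$ 0 = of_bool (i = j)"
proof
  define m where "m i j r = M $ i $ j $$ r" for i j r
  define X :: "'a fps ^ 'n ^ 'n" where "X = (\<chi> i j. Abs_fps (\<lambda>r. mat_rinv m r i j))"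
  have *: "(\<Sum>b\<in>UNIV. \<Sum>s=0..n. m i b (n - s) * mat_rinv m s b j) = (if n = 0 then of_bool (i = j) else 0)"
    for i j n
  proof (cases n)
    case 0
    then show ?thesis by (simp add: m_def assms mat_rinv.simps)
  next
    case (Suc k)
    have "(\<Sum>b\<in>UNIV. \<Sum>s=0..n. m i b (n - s) * mat_rinv m s b j) =
        (\<Sum>s\<le>n. \<Sum>b\<in>UNIV. m i b (n - s) * mat_rinv m s b j)"
      unfolding atMost_atLeast0 by (rule sum.swap)
    also have "\<dots> = (\<Sum>s<n. \<Sum>b\<in>UNIV. m i b (n - s) * mat_rinv m s b j) + mat_rinv m n i j"
      unfolding lessThan_Suc_atMost[symmetric] by (simp add: m_def assms)
    also have "mat_rinv m n i j = - (\<Sum>s<n. \<Sum>b\<in>UNIV. m i b (n - s) * mat_rinv m s b j)"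
      unfolding Suc lessThan_Suc_atMost by (rule mat_rinv.simps)
    finally show ?thesis using Suc by simp
  qed
  have rev: "(\<Sum>s=0..n. m i b s * mat_rinv m (n - s) b j) = (\<Sum>s=0..n. m i b (n - s) * mat_rinv m s b j)"
    for i b j n
    by (subst sum.atLeastAtMost_rev) simp
  have "(\<Sum>b\<in>UNIV. \<Sum>s=0..n. m i b s * mat_rinv m (n - s) b j) = (if n = 0 then of_bool (i = j) else 0)"
    for i j n
    unfolding rev by (rule * )
  then have "(M ** X) $ i $ j $$ n = mat 1 $ i $ j $$ n" for i j n
    unfolding matrix_matrix_mult_def X_def mat_def m_def[symmetric]
    by (simp add: fps_sum_nth fps_mult_nth m_def[symmetric])
  then show "M ** X = mat 1"
    by (simp add: vec_eq_iff fps_eq_iff)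
  show "X $ i $ j $$ 0 = of_bool (i = j)" for i j
    by (simp add: X_def mat_rinv.simps)
qed

text \<open>The right inverse again has constant term 1, so it has a right inverse itself, which
  must be \<open>M\<close>.\<close>

lemma fps_matrix_invertible:
  fixes M :: "'a::ring_1 fps ^ 'n::finite ^ 'n"
  assumes "\<And>i j. M $ i $ j $$ 0 = of_bool (i = j)"
  shows "invertible M"
proof -
  obtain X where X: "M ** X = mat 1" "\<And>i j. X $ i $ j $$ 0 = of_bool (i = j)"
    using fps_matrix_right_inverse[of M, OF assms] by metis
  obtain Z where Z: "X ** Z = mat 1"
    by (rule fps_matrix_right_inverse[of X, OF X(2)])
  have "M = M ** (X ** Z)" by (simp add: Z)
  also have "\<dots> = Z" by (simp add: matrix_mul_assoc X)
  finally show ?thesis using X Z by (auto simp: invertible_def)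
qed

lemma Dser_Dtilde: "(\<Sum>b\<in>UNIV. Dser a b * Dtilde b c) = of_bool (a = c)"
proof -
  have "invertible Dmat"
    by (intro fps_matrix_invertible) (simp add: Dmat_def Dser_def Sser_eq yS_0)
  then have "Dmat ** matrix_inv Dmat = mat 1"
    unfolding invertible_def matrix_inv_def by (rule someI2_ex) auto
  then have "(Dmat ** matrix_inv Dmat) $ a $ c = of_bool (a = c)"
    by (simp add: mat_def)
  then show ?thesis
    by (simp add: matrix_matrix_mult_def Dmat_def Dtilde_def)
qed

lemma Dser_Eser: "(\<Sum>b\<in>UNIV. Dser a b * Eser b) = Sser (Sgn a) Zero"
proof -
  have "(\<Sum>b\<in>UNIV. Dser a b * Eser b) =
      (\<Sum>c\<in>UNIV. (\<Sum>b\<in>UNIV. Dser a b * Dtilde b c) * Sser (Sgn c) Zero)"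
    unfolding Eser_def sum_distrib_left sum_distrib_right mult.assoc by (rule sum.swap)
  then show ?thesis by (simp add: Dser_Dtilde if_zero_mult of_bool_def)
qed

lemma Gser_eq: "Gser = Sser Zero Zero - (\<Sum>a\<in>UNIV. Sser Zero (Sgn a) * Eser a)"
  unfolding Gser_def Eser_def by (simp add: sum_distrib_left mult.assoc)

text \<open>Isolates the top coefficient of the second factor; where \<open>f $$ 0\<close> is known,
  this lets \<open>E\<close> and \<open>G\<close> be computed recursively from
  \<open>S\<close>.\<close>

lemma fps_mult_nth_split: "(f * g) $$ r = f $$ 0 * g $$ r + (\<Sum>s<r. f $$ (r - s) * g $$ s)"
  for f g :: "'a::ring_1 fps"
proof -
  have "(f * g) $$ r = (\<Sum>s\<le>r. f $$ (r - s) * g $$ s)"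
    unfolding fps_mult_nth atMost_atLeast0[symmetric] by (subst sum_atMost_rev) simp
  then show ?thesis
    by (simp add: lessThan_Suc_atMost[symmetric] add.commute)
qed

definition yE :: "pm \<Rightarrow> nat \<Rightarrow> yangian3" where
  "yE a r = Eser a $$ r"

lemma yE_0: "yE a 0 = 0"
  by (simp add: yE_def Eser_def fps_sum_nth Sser_eq yS_0)

lemma yS_Sgn_Zero:
  "yS (Sgn a) Zero r = yE a r + (\<Sum>b\<in>UNIV. \<Sum>s<r. yS (Sgn a) (Sgn b) (r - s) * yE b s)"
proof -
  have "yS (Sgn a) Zero r = (\<Sum>b\<in>UNIV. Dser a b * Eser b) $$ r"
    by (simp add: Dser_Eser Sser_eq)
  then show ?thesis
    by (simp add: fps_sum_nth fps_mult_nth_split[of "Abs_fps _"] Dser_def Sser_eq yE_def yS_0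
        sum.distrib of_bool_def if_zero_mult)
qed

lemma yS_Zero_Zero:
  "yS Zero Zero r = Gser $$ r + (\<Sum>a\<in>UNIV. \<Sum>s<r. yS Zero (Sgn a) (r - s) * yE a s)"
  by (simp add: Gser_eq fps_sum_nth fps_mult_nth_split[of "Abs_fps _"] Sser_eq yE_def yS_0)

section \<open>Spanning\<close>

fun weight :: "label \<Rightarrow> nat" where
  "weight (EGen i m) = m"
| "weight (DGen k l r) = r"
| "weight (GGen t) = t"

lemma drinfeld_eq: "drinfeld (EGen i m) = yE i m" "drinfeld (DGen k l r) = yS (Sgn k) (Sgn l) r"
  by (simp_all add: yE_def Dser_def Sser_eq)

lemma fil_yE: "fil r (yE a r)"
proof (induction r arbitrary: a rule: less_induct)
  case (less r)
  have "yE a r = yS (Sgn a) Zero r - (\<Sum>b\<in>UNIV. \<Sum>s<r. yS (Sgn a) (Sgn b) (r - s) * yE b s)"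
    by (simp add: yS_Sgn_Zero)
  also have "fil r \<dots>"
    by (intro fil_diff fil_yS fil_sum fil_mult_le[OF fil_yS less]) simp_all
  finally show ?case .
qed

lemma fil_drinfeld: "fil (weight l) (drinfeld l)"
proof (cases l)
  case (GGen t)
  have "Gser $$ t = yS Zero Zero t - (\<Sum>a\<in>UNIV. \<Sum>s<t. yS Zero (Sgn a) (t - s) * yE a s)"
    by (simp add: yS_Zero_Zero)
  also have "fil t \<dots>"
    by (intro fil_diff fil_yS fil_sum fil_mult_le[OF fil_yS fil_yE]) simp_all
  finally show ?thesis by (simp add: GGen)
qed (auto simp only: drinfeld_eq weight.simps intro: fil_yE fil_yS)

lemma fil_pbw_monomial: "fil (sum_list (map weight xs)) (pbw_monomial xs)"
  by (induction xs) (auto simp: pbw_monomial_def intro: fil_one fil_mult fil_drinfeld)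

text \<open>Letters may come in any order here, so that products are concatenations; sorting is
  postponed to \<open>span_ordered_words\<close>.\<close>

definition word_span :: "nat \<Rightarrow> yangian3 set" where
  "word_span d = Y.span (pbw_monomial ` {xs. set xs \<subseteq> pbw_labels \<and> sum_list (map weight xs) \<le> d})"

lemma word_span_base:
  "set xs \<subseteq> pbw_labels \<Longrightarrow> sum_list (map weight xs) \<le> d \<Longrightarrow> pbw_monomial xs \<in> word_span d"
  unfolding word_span_def by (intro Y.span_base) auto

lemma word_span_mono: "d \<le> e \<Longrightarrow> word_span d \<subseteq> word_span e"
  unfolding word_span_def by (intro Y.span_mono) auto

lemma word_span_one: "1 \<in> word_span d"
  using word_span_base[of "[]" d] by (simp add: pbw_monomial_def)

lemma word_span_label: "l \<in> pbw_labels \<Longrightarrow> weight l \<le> d \<Longrightarrow> drinfeld l \<in> word_span d"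
  using word_span_base[of "[l]" d] by (simp add: pbw_monomial_def)

lemma pbw_monomial_append: "pbw_monomial (xs @ ys) = pbw_monomial xs * pbw_monomial ys"
  by (simp add: pbw_monomial_def)

lemma word_span_mult:
  assumes "x \<in> word_span a" "y \<in> word_span b" "a + b \<le> d"
  shows "x * y \<in> word_span d"
proof -
  have *: "pbw_monomial xs * y \<in> word_span d"
    if xs: "set xs \<subseteq> pbw_labels" "sum_list (map weight xs) \<le> a" for xs
    using assms(2) unfolding word_span_def[of b]
  proof (induction rule: Y.span_induct_alt)
    case base
    then show ?case by (simp add: word_span_def Y.span_zero)
  next
    case (step c y z)
    then obtain ys where "set ys \<subseteq> pbw_labels" "sum_list (map weight ys) \<le> b" "y = pbw_monomial ys"
      by auto
    with xs assms(3) have "pbw_monomial xs * y \<in> word_span d"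
      by (simp add: pbw_monomial_append[symmetric] word_span_base)
    with step show ?case
      unfolding word_span_def distrib_left yscale_mult_right by (intro Y.span_add Y.span_scale)
  qed
  show ?thesis
    using assms(1) unfolding word_span_def[of a]
  proof (induction rule: Y.span_induct_alt)
    case base
    then show ?case by (simp add: word_span_def Y.span_zero)
  next
    case (step c x z)
    then have "x * y \<in> word_span d" using * by auto
    with step show ?case
      unfolding word_span_def distrib_right yscale_mult_left by (intro Y.span_add Y.span_scale)
  qed
qed

lemma word_span_closed:
  "0 \<in> word_span d"
  "x \<in> word_span d \<Longrightarrow> y \<in> word_span d \<Longrightarrow> x + y \<in> word_span d"
  "x \<in> word_span d \<Longrightarrow> y \<in> word_span d \<Longrightarrow> x - y \<in> word_span d"
  "x \<in> word_span d \<Longrightarrow> - x \<in> word_span d"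
  "x \<in> word_span d \<Longrightarrow> yscale c x \<in> word_span d"
  "(\<And>a. a \<in> A \<Longrightarrow> f a \<in> word_span d) \<Longrightarrow> sum f A \<in> word_span d"
  unfolding word_span_def
  by (rule Y.span_zero Y.span_add Y.span_diff Y.span_neg Y.span_scale Y.span_sum; assumption)+

lemma word_span_yE: "r > 0 \<Longrightarrow> r \<le> d \<Longrightarrow> yE a r \<in> word_span d"
  using word_span_label[of "EGen a r" d] by (simp add: drinfeld_eq pbw_labels_def del: drinfeld.simps)

lemma half_double: "x = yscale (1 / 2) (x + x)"
proof -
  have "x + x = yscale 2 x"
    using Y.scale_left_distrib[of 1 1 x] by simp
  then show ?thesis by simp
qed

lemma word_span_double: "2 * x \<in> word_span d \<longleftrightarrow> x \<in> word_span d"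
proof
  assume "2 * x \<in> word_span d"
  then have "x + x \<in> word_span d" by (simp add: mult_2)
  then have "yscale (1 / 2) (x + x) \<in> word_span d" by (rule word_span_closed)
  then show "x \<in> word_span d" by (simp add: half_double[symmetric])
qed (simp add: mult_2 word_span_closed)

lemma word_span_sign: "(- 1) ^ n * x \<in> word_span d \<longleftrightarrow> x \<in> word_span d"
  using word_span_closed(4)[of x d] word_span_closed(4)[of "- x" d] by (cases "even n") auto

lemma word_span_yS_symmetry:
  assumes "yS i j n \<in> word_span d"
  shows "(- 1) ^ Suc n * yS (- j) (- i) (Suc n) - yS i j (Suc n) \<in> word_span d"
proof -
  have "yS i j n - (- 1) ^ n * yS i j n \<in> word_span d"
    using assms word_span_sign word_span_closed(3) by blast
  then show ?thesis
    unfolding yS_symmetry[symmetric] word_span_double .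
qed

text \<open>By the symmetry relation \<open>yS i j r\<close> and \<open>yS (- j) (- i) r\<close>
  determine each other modulo smaller superscripts. So the admissible \<open>D\<close> yield every
  \<open>D\<close>, the \<open>E\<close> then yield the column and row at \<open>Zero\<close>, and
  the even \<open>G\<close> the corner.\<close>

lemma word_span_yS: "yS i j r \<in> word_span r"
proof (induction r arbitrary: i j rule: less_induct)
  case (less r)
  show ?case
  proof (cases r)
    case 0
    then show ?thesis
      by (simp add: yS_0 word_span_one word_span_closed(1))
  next
    case (Suc n)
    have IH: "yS i j s \<in> word_span e" if "s \<le> n" "s \<le> e" for i j s e
      using less[of s i j] word_span_mono[OF that(2)] that(1) Suc by auto
    have sym: "(- 1) ^ r * yS (- j) (- i) r - yS i j r \<in> word_span r" for i j
      unfolding Suc by (intro word_span_yS_symmetry IH) simp_all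
    have flip: "yS (- j) (- i) r \<in> word_span r" if "yS i j r \<in> word_span r" for i j
    proof -
      have "(- 1) ^ r * yS (- j) (- i) r - yS i j r + yS i j r \<in> word_span r"
        by (intro word_span_closed sym that)
      then show ?thesis by (simp add: word_span_sign)
    qed
    \<comment> \<open>For \<open>j = - i\<close> the flip fixes the pair of indices, and for odd
      \<open>r\<close> the symmetry relation contains \<open>- 2 * yS i (- i) r\<close>.\<close>
    have anti: "yS i (- i) r \<in> word_span r" if "odd r" for i
    proof -
      have "2 * yS i (- i) r \<in> word_span r"
        using word_span_closed(4)[OF sym[where i = i and j = "- i"]] that by (simp add: mult_2)
      then show ?thesis by (simp only: word_span_double)
    qed
    have D: "yS (Sgn a) (Sgn b) r \<in> word_span r" for a b
    proof -
      have adm: "yS (Sgn a) (Sgn b) r \<in> word_span r"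
        if "admissible (int_of_pm a) (int_of_pm b) (int r)" for a b
        using word_span_label[of "DGen a b r" r] that Suc by (simp add: drinfeld_eq pbw_labels_def del: drinfeld.simps)
      have "yS (Sgn Minus) (Sgn Minus) r \<in> word_span r"
        by (rule adm) (simp add: admissible_def)
      moreover from flip[OF this] have "yS (Sgn Plus) (Sgn Plus) r \<in> word_span r"
        by simp
      \<comment> \<open>The indices add up to 0, which is admissible exactly for even
        \<open>r\<close>.\<close>
      moreover have "yS (Sgn a) (- Sgn a) r \<in> word_span r" for a
      proof (cases "even r")
        case True
        then show ?thesis
          by (cases a) (auto intro!: adm simp: admissible_def)
      qed (rule anti)
      from this[of Plus] this[of Minus]
      have "yS (Sgn Plus) (Sgn Minus) r \<in> word_span r" "yS (Sgn Minus) (Sgn Plus) r \<in> word_span r"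
        by simp_all
      ultimately show ?thesis by (cases a; cases b) simp_all
    qed
    have yE: "yE b s \<in> word_span s" for b s
      by (cases s) (simp_all add: yE_0 word_span_closed(1) word_span_yE)
    \<comment> \<open>As \<open>yE b 0 = 0\<close>, the term \<open>s = 0\<close>, in which
      \<open>yS\<close> would have superscript \<open>r\<close> outside the induction hypothesis, is
      zero.\<close>
    have prod: "yS i j (r - s) * yE b s \<in> word_span r" if "s < r" for i j b s
    proof (cases s)
      case (Suc s')
      then show ?thesis
        using that \<open>r = Suc n\<close> by (intro word_span_mult[OF IH yE, of _ "r - s"]) simp_all
    qed (simp add: yE_0 word_span_closed(1))
    have E: "yS (Sgn a) Zero r \<in> word_span r" for a
      unfolding yS_Sgn_Zero by (intro word_span_closed prod yE) simp
    have E': "yS Zero (Sgn a) r \<in> word_span r" for a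
      using flip[OF E[of Plus]] flip[OF E[of Minus]] by (cases a) simp_all
    have "yS Zero Zero r \<in> word_span r"
    proof (cases "even r")
      case True
      then have "Gser $$ r \<in> word_span r"
        using word_span_label[of "GGen r" r] Suc by (simp add: pbw_labels_def)
      then show ?thesis
        unfolding yS_Zero_Zero by (intro word_span_closed prod) simp_all
    next
      case False
      then show ?thesis using anti[of Zero] by simp
    qed
    with D E E' show ?thesis
      by (cases i; cases j) simp_all
  qed
qed

lemma fil_imp_word_span: "fil d x \<Longrightarrow> x \<in> word_span d"
proof (induction rule: fil.induct)
  case (fil_mono d x e)
  then show ?case using word_span_mono by blast
qed (auto intro: word_span_one word_span_yS word_span_closed word_span_mult)

section \<open>Sorting words modulo lower weight\<close>

lemma low_remove_letter:
  "low (sum_list (map weight us) + weight l + sum_list (map weight vs))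
    (pbw_monomial (us @ l # vs) - pbw_monomial (l # us @ vs))"
proof -
  have "pbw_monomial (us @ l # vs) - pbw_monomial (l # us @ vs) =
      (pbw_monomial us * drinfeld l - drinfeld l * pbw_monomial us) * pbw_monomial vs"
    by (simp add: pbw_monomial_def algebra_simps)
  then show ?thesis
    using low_mult_left[OF fil_pbw_monomial low_commutator[OF fil_pbw_monomial fil_drinfeld]] by simp
qed

text \<open>The first letter of \<open>xs\<close> is brought to the front of \<open>ys\<close> at
  the cost of a commutator of lower weight; the rest is compared by induction.\<close>

lemma low_permute:
  "mset xs = mset ys \<Longrightarrow> low (sum_list (map weight xs)) (pbw_monomial xs - pbw_monomial ys)"
proof (induction xs arbitrary: ys)
  case Nil
  then show ?case by (simp add: low_zero)
next
  case (Cons x xs)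
  then have "x \<in> set ys" by (metis list.set_intros(1) mset_eq_setD)
  then obtain us vs where ys: "ys = us @ x # vs" by (meson split_list)
  with Cons.prems have m: "mset xs = mset (us @ vs)" by simp
  then have w: "sum_list (map weight xs) = sum_list (map weight us) + sum_list (map weight vs)"
    by (metis map_append mset_map sum_list.append sum_mset_sum_list)
  have "low (weight x + sum_list (map weight xs))
      (drinfeld x * (pbw_monomial xs - pbw_monomial (us @ vs)) + - (pbw_monomial ys - pbw_monomial (x # us @ vs)))"
    using low_mult_right[OF fil_drinfeld Cons.IH[OF m], of x] low_remove_letter[of us x vs]
    by (intro low_add low_uminus) (simp_all add: ys w add_ac)
  then show ?case
    by (simp add: pbw_monomial_def algebra_simps)
qed

text \<open>Insertion sort, for an order that is a relation on a set rather than a class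
  instance.\<close>

lemma linear_order_on_sort:
  assumes "linear_order_on A r" "set xs \<subseteq> A"
  obtains ys where "mset ys = mset xs" "sorted_wrt (\<lambda>x y. (x, y) \<in> r) ys"
proof -
  have r: "trans r" "total_on A r" "refl_on A r"
    using assms(1) by (auto simp: linear_order_on_def partial_order_on_def preorder_on_def)
  have "\<exists>ys. mset ys = mset xs \<and> sorted_wrt (\<lambda>x y. (x, y) \<in> r) ys"
    using assms(2)
  proof (induction xs)
    case Nil
    then show ?case by auto
  next
    case (Cons x xs)
    then obtain ys where ys: "mset ys = mset xs" "sorted_wrt (\<lambda>x y. (x, y) \<in> r) ys" by auto
    define us where "us = filter (\<lambda>y. (y, x) \<in> r) ys"
    define vs where "vs = filter (\<lambda>y. (y, x) \<notin> r) ys"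
    have sub: "set ys \<subseteq> A" "x \<in> A" using ys(1) Cons.prems by (auto dest: mset_eq_setD)
    have vs: "(x, y) \<in> r" if "y \<in> set vs" for y
    proof -
      from that sub have "y \<in> A" "(y, x) \<notin> r" by (auto simp: vs_def)
      with r sub show ?thesis by (metis refl_onD total_on_def)
    qed
    have "mset (us @ x # vs) = mset (x # xs)"
      by (simp add: us_def vs_def ys(1)[symmetric])
    moreover have "sorted_wrt (\<lambda>x y. (x, y) \<in> r) (us @ x # vs)"
      using ys(2) vs r(1)
      by (auto simp: sorted_wrt_append us_def vs_def sorted_wrt_filter dest: transD)
    ultimately show ?case by blast
  qed
  with that show thesis by blast
qed

lemma linear_order_on_sorted_unique:
  assumes "linear_order_on A r"
    and "sorted_wrt (\<lambda>x y. (x, y) \<in> r) xs" "sorted_wrt (\<lambda>x y. (x, y) \<in> r) ys" "mset xs = mset ys"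
  shows "xs = ys"
  using assms(2-)
proof (induction xs arbitrary: ys)
  case (Cons x xs)
  then obtain y ys' where ys: "ys = y # ys'" by (cases ys) auto
  have "antisym r" using assms(1) by (simp add: linear_order_on_def partial_order_on_def)
  moreover have "x \<in> set ys" "y \<in> set (x # xs)"
    using Cons.prems(3) mset_eq_setD[OF Cons.prems(3)] ys by auto
  ultimately have "x = y"
    using Cons.prems(1,2) ys by (auto dest: antisymD)
  with Cons ys show ?case by auto
qed simp

text \<open>Sorting a word changes it only by something of lower weight, so induction on the weight
  reduces all words to ordered ones.\<close>

lemma span_ordered_words:
  assumes "linear_order_on pbw_labels ord"
  shows "Y.span (pbw_monomial ` ordered_words ord) = twisted_yangian"
proof
  have sub: "subalgebra twisted_yangian"
    unfolding twisted_yangian_def by (rule hull_in) (auto simp: subalgebra_def)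
  have fil_tw: "x \<in> twisted_yangian" if "fil d x" for d x
    using that
  proof (induction rule: fil.induct)
    case (fil_yS r i j)
    \<comment> \<open>Superscript 0 is not among the generators of the hull, but
      \<open>yS i j 0\<close> is 0 or 1.\<close>
    have "1 \<in> twisted_yangian" "yscale 0 1 \<in> twisted_yangian"
      using sub unfolding subalgebra_def by blast+
    moreover have "yS i j r \<in> twisted_yangian" if "r \<ge> 1"
      unfolding twisted_yangian_def by (rule hull_inc) (use that in \<open>auto simp: Sser_eq\<close>)
    ultimately show ?case by (cases r) (auto simp: yS_0)
  qed (use sub in \<open>auto simp: subalgebra_def\<close>)
  show "Y.span (pbw_monomial ` ordered_words ord) \<subseteq> twisted_yangian"
  proof
    fix x assume "x \<in> Y.span (pbw_monomial ` ordered_words ord)"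
    then show "x \<in> twisted_yangian"
    proof (induction rule: Y.span_induct_alt)
      case base
      show ?case using fil_tw fil_zero by blast
    next
      case (step c x y)
      then have "x \<in> twisted_yangian" using fil_tw fil_pbw_monomial by auto
      with step sub show ?case by (auto simp: subalgebra_def)
    qed
  qed
  let ?V = "Y.span (pbw_monomial ` ordered_words ord)"
  have "word_span d \<subseteq> ?V" for d
  proof (induction d rule: less_induct)
    case (less d)
    have "pbw_monomial xs \<in> ?V" if xs: "set xs \<subseteq> pbw_labels" "sum_list (map weight xs) \<le> d" for xs
    proof -
      obtain ys where ys: "mset ys = mset xs" "sorted_wrt (\<lambda>x y. (x, y) \<in> ord) ys"
        using linear_order_on_sort[OF assms xs(1)] by blast
      then have "pbw_monomial ys \<in> ?V"
        using xs(1) mset_eq_setD[OF ys(1)] by (intro Y.span_base) (auto simp: ordered_words_def)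
      moreover have "low d (pbw_monomial xs - pbw_monomial ys)"
        using low_permute[OF ys(1)[symmetric]] low_mono xs(2) by blast
      then have "pbw_monomial xs - pbw_monomial ys \<in> ?V"
        using less fil_imp_word_span by (cases d) (auto simp: Y.span_zero)
      ultimately show ?thesis
        using Y.span_add by fastforce
    qed
    then show ?case
      unfolding word_span_def by (intro Y.span_minimal) auto
  qed
  then have fil_V: "x \<in> ?V" if "fil d x" for d x
    using that fil_imp_word_span by blast
  \<comment> \<open>The union of the filtration steps is a subalgebra containing the generators,
    hence contains the hull.\<close>
  have "subalgebra {x. \<exists>d. fil d x}"
    by (auto simp: subalgebra_def intro: fil_one fil_scale fil_mult)
      (meson fil_add fil_mono linear)
  then have "twisted_yangian \<subseteq> {x. \<exists>d. fil d x}"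
    unfolding twisted_yangian_def by (intro hull_minimal) (auto simp: Sser_eq intro: fil_yS)
  then show "twisted_yangian \<subseteq> ?V" using fil_V by blast
qed

section \<open>Homomorphisms out of the Yangian\<close>

lemma leg_commute:
  assumes "\<And>i j r k l s. A i j r * B k l s = B k l s * A i j r"
  shows "leg1 A ** leg2 B = leg2 B ** leg1 A"
  by (simp add: vec_eq_iff fst_snd_leg_nth snd_fst_leg_nth fps_eq_iff fst_snd_ser_nth
      snd_fst_ser_nth assms del: fps_mult_nth_0)

lemma rtt_conv:
  assumes A: "rtt A" and B: "rtt B" and "\<And>i j r k l s. A i j r * B k l s = B k l s * A i j r"
  shows "rtt (conv A B)"
proof -
  have 0: "A i j 0 = of_bool (i = j)" "B i j 0 = of_bool (i = j)" for i j
    using A B by (simp_all add: rtt_def)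
  then have "conv A B i j 0 = of_bool (i = j)" for i j
    by (simp add: conv_0 of_bool_def if_zero_mult)
  moreover have "Rser ** ((leg1 A ** leg1 B) ** (leg2 A ** leg2 B)) =
      (leg2 A ** leg2 B) ** (leg1 A ** leg1 B) ** Rser"
    using A B assms(3)
    by (intro RTT_product leg_commute leg_commute[symmetric]) (simp_all add: rtt_iff 0)
  ultimately show ?thesis
    by (simp add: rtt_iff leg_mult)
qed

text \<open>Iterating the recursion down to \<open>r = 0\<close>, where the commutator vanishes,
  restores the expansion of \<open>1 / (u - v)\<close> in the form of \<open>yrel\<close>.\<close>

lemma rtt_commutator:
  assumes "rtt A"
  shows "A i j r * A k l s - A k l s * A i j r =
    (\<Sum>a<r. A k j (r - 1 - a) * A i l (s + a) - A k j (s + a) * A i l (r - 1 - a))"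
proof (induction r arbitrary: s)
  case 0
  then show ?case using assms by (simp add: rtt_def)
next
  case (Suc r)
  have "(A i j (Suc r) * A k l s - A k l s * A i j (Suc r)) -
      (A i j r * A k l (Suc s) - A k l (Suc s) * A i j r) = A k j r * A i l s - A k j s * A i l r"
    using assms unfolding rtt_def by blast
  then have "A i j (Suc r) * A k l s - A k l s * A i j (Suc r) =
      (A k j r * A i l s - A k j s * A i l r) + (A i j r * A k l (Suc s) - A k l (Suc s) * A i j r)"
    unfolding diff_eq_eq .
  then show ?case
    unfolding Suc.IH sum.lessThan_Suc_shift by simp
qed

lemma (in scalar_map) yangian_hom:
  fixes A :: "idx \<Rightarrow> idx \<Rightarrow> nat \<Rightarrow> 'b"
  assumes "rtt A"
  obtains \<Phi> :: "yangian3 \<Rightarrow> 'b" where "\<Phi> 1 = 1" "\<And>x y. \<Phi> (x + y) = \<Phi> x + \<Phi> y"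
    "\<And>x y. \<Phi> (x * y) = \<Phi> x * \<Phi> y" "\<And>a x. \<Phi> (yscale a x) = c a * \<Phi> x"
    "\<And>i j r. \<Phi> (yT i j r) = A i j r"
proof
  \<comment> \<open>\<open>Gen i j n\<close> stands for the superscript
    \<open>n + 1\<close>.\<close>
  define f where "f g = (case g of Gen i j n \<Rightarrow> A i j (Suc n))" for g
  \<comment> \<open>Evaluation at a chosen representative; \<open>ideal\<close> below makes the
    value independent of the choice.\<close>
  define \<Phi> where "\<Phi> y = free_eval c f (rep_yangian3 y)" for y
  have T: "free_eval c f (fT i j r) = A i j r" for i j r
    using assms by (simp add: eval_T f_def rtt_def)
  have rel: "free_eval c f (yrel i j k l r s) = 0" for i j k l r s
    using rtt_commutator[OF assms] by (simp add: yrel_def eval_diff eval_sum eval_mult T)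
  have ideal: "free_eval c f x = 0" if "x \<in> yideal" for x
    using that by (induction rule: yideal.induct) (simp_all add: eval_zero eval_add eval_mult rel)
  have \<Phi>: "\<Phi> (abs_yangian3 x) = free_eval c f x" for x
  proof -
    have "rep_yangian3 (abs_yangian3 x) - x \<in> yideal"
      using Quotient3_rep_abs[OF Quotient3_yangian3] by (auto simp: yideal.zero)
    then show ?thesis
      unfolding \<Phi>_def using ideal[of "rep_yangian3 (abs_yangian3 x) - x"] by (simp add: eval_diff)
  qed
  show "\<Phi> 1 = 1"
    by (simp add: one_yangian3.abs_eq \<Phi> eval_one)
  show "\<Phi> (yT i j r) = A i j r" for i j r
    by (simp add: yT.abs_eq \<Phi> T)
  show "\<Phi> (x + y) = \<Phi> x + \<Phi> y" for x y
    by (induction x, induction y) (simp add: \<Phi> plus_yangian3.abs_eq eval_add)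
  show "\<Phi> (x * y) = \<Phi> x * \<Phi> y" for x y
    by (induction x, induction y) (simp add: \<Phi> times_yangian3.abs_eq eval_mult)
  show "\<Phi> (yscale a x) = c a * \<Phi> x" for x a
    by (induction x) (simp add: \<Phi> yscale.abs_eq eval_mult eval_const)
qed

section \<open>Linear operators\<close>

text \<open>Three coordinates at each of infinitely many sites; the model with \<open>n\<close>
  factors moves only the sites below \<open>n\<close>.\<close>

type_synonym point = "nat \<Rightarrow> idx \<Rightarrow> complex"

typedef endo = "{F :: (point \<Rightarrow> complex) \<Rightarrow> point \<Rightarrow> complex.
    \<forall>a x y. F (\<lambda>k. a * x k + y k) = (\<lambda>k. a * F x k + F y k)}"
  morphisms app Abs_endo
  by (rule exI[of _ "\<lambda>x. x"]) simp

setup_lifting type_definition_endo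

lemma endo_eqI: "(\<And>f k. app F f k = app G f k) \<Longrightarrow> F = G"
  by (simp add: app_inject[symmetric] fun_eq_iff)

lemma app_linear: "app F (\<lambda>k. a * x k + y k) = (\<lambda>k. a * app F x k + app F y k)"
  using app[of F] by simp

lemma app_zero: "app F (\<lambda>k. 0) = (\<lambda>k. 0)"
  using app_linear[of F 1 "\<lambda>k. 0" "\<lambda>k. 0"] by (simp add: fun_eq_iff)

lemma app_add: "app F (\<lambda>k. x k + y k) = (\<lambda>k. app F x k + app F y k)"
  using app_linear[of F 1 x y] by simp

lemma app_scale: "app F (\<lambda>k. a * x k) = (\<lambda>k. a * app F x k)"
  using app_linear[of F a x "\<lambda>k. 0"] by (simp add: app_zero)

instantiation endo :: ring_1
begin

lift_definition zero_endo :: endo is "\<lambda>_ _. 0"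
  by simp

lift_definition one_endo :: endo is "\<lambda>x. x"
  by simp

lift_definition plus_endo :: "endo \<Rightarrow> endo \<Rightarrow> endo" is "\<lambda>F G x k. F x k + G x k"
  by (simp add: algebra_simps)

lift_definition uminus_endo :: "endo \<Rightarrow> endo" is "\<lambda>F x k. - F x k"
  by (simp add: algebra_simps)

lift_definition minus_endo :: "endo \<Rightarrow> endo \<Rightarrow> endo" is "\<lambda>F G x k. F x k - G x k"
  by (simp add: algebra_simps)

lift_definition times_endo :: "endo \<Rightarrow> endo \<Rightarrow> endo" is "\<lambda>F G x. F (G x)"
  by simp

lemmas endo_rep_eq = zero_endo.rep_eq one_endo.rep_eq plus_endo.rep_eq uminus_endo.rep_eq
  minus_endo.rep_eq times_endo.rep_eq

instance
proof
  fix a b c :: endo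
  have "app 0 (\<lambda>_. 1) undefined \<noteq> app 1 (\<lambda>_. 1) undefined"
    by (simp add: endo_rep_eq)
  then show "(0 :: endo) \<noteq> 1" by auto
  show "a * (b + c) = a * b + a * c"
    by (rule endo_eqI) (simp add: endo_rep_eq app_add)
qed (rule endo_eqI, simp add: endo_rep_eq algebra_simps)+

end

lift_definition esc :: "complex \<Rightarrow> endo" is "\<lambda>a x k. a * x k"
  by (simp add: algebra_simps)

interpretation endo: scalar_map esc
  by standard (rule endo_eqI; simp add: endo_rep_eq esc.rep_eq app_scale algebra_simps)+

section \<open>Oscillator realization of gl_3\<close>

definition move :: "nat \<Rightarrow> idx \<Rightarrow> complex \<Rightarrow> point \<Rightarrow> point" where
  "move a i c k = (\<lambda>b j. if b = a \<and> j = i then k b j + c else k b j)"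

text \<open>Up to the gauge \<open>w\<close>, multiplication by $x_i$ and $\partial_i$, acting on the coefficients of
  $x^k / k!$; they make sense at every complex \<open>k\<close>.\<close>

lift_definition raising :: "(nat \<Rightarrow> idx \<Rightarrow> complex) \<Rightarrow> nat \<Rightarrow> idx \<Rightarrow> endo" is
  "\<lambda>w a i f k. k a i / w a i * f (move a i (- 1) k)"
  by (simp add: algebra_simps)

lift_definition lowering :: "(nat \<Rightarrow> idx \<Rightarrow> complex) \<Rightarrow> nat \<Rightarrow> idx \<Rightarrow> endo" is
  "\<lambda>w a j f k. w a j * f (move a j 1 k)"
  by (simp add: algebra_simps)

lemma move_commute: "move a i c (move b j d k) = move b j d (move a i c k)"
  by (auto simp: move_def fun_eq_iff)

lemma move_inverse: "move a i 1 (move a i (- 1) k) = k"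
  by (auto simp: move_def fun_eq_iff)

lemma move_inverse': "move a i (- 1) (move a i 1 k) = k"
  by (auto simp: move_def fun_eq_iff)

lemma lowering_commute: "lowering w a i * lowering w b j = lowering w b j * lowering w a i"
  by (rule endo_eqI) (simp add: times_endo.rep_eq lowering.rep_eq move_commute[of a i])

lemma raising_commute: "raising w a i * raising w b j = raising w b j * raising w a i"
  by (rule endo_eqI) (auto simp: times_endo.rep_eq raising.rep_eq move_commute[of a i], auto simp: move_def mult_ac)

text \<open>The canonical commutation relation: at the same coordinate the two orders multiply by
  \<open>k + 1\<close> and by \<open>k\<close>, the gauge \<open>w\<close> cancelling.\<close>

lemma lowering_raising:
  assumes "w a i \<noteq> 0"
  shows "lowering w a i * raising w b j = raising w b j * lowering w a i + of_bool (a = b \<and> i = j)"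
proof (cases "a = b \<and> i = j")
  case True
  then have "lowering w a i * raising w b j = raising w b j * lowering w a i + 1"
    using assms
    by (intro endo_eqI)
      (simp add: endo_rep_eq raising.rep_eq lowering.rep_eq move_inverse move_inverse',
       simp add: move_def field_simps)
  with True show ?thesis by simp
next
  case False
  then have "lowering w a i * raising w b j = raising w b j * lowering w a i"
    by (intro endo_eqI)
      (simp add: endo_rep_eq raising.rep_eq lowering.rep_eq move_commute[of b j], auto simp: move_def)
  with False show ?thesis by auto
qed

definition gl_op :: "(nat \<Rightarrow> idx \<Rightarrow> complex) \<Rightarrow> nat \<Rightarrow> idx \<Rightarrow> idx \<Rightarrow> endo" where
  "gl_op w a i j = raising w a i * lowering w a j"

text \<open>Normal ordering. The first term is symmetric in the two factors, so commutators come
  from the correction alone.\<close>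

lemma gl_op_mult:
  assumes "\<And>a i. w a i \<noteq> 0"
  shows "gl_op w a i j * gl_op w b k l =
    raising w a i * raising w b k * (lowering w a j * lowering w b l) +
    of_bool (a = b \<and> j = k) * (raising w a i * lowering w b l)"
proof -
  have "gl_op w a i j * gl_op w b k l =
      raising w a i * (lowering w a j * raising w b k) * lowering w b l"
    by (simp add: gl_op_def mult.assoc)
  then show ?thesis
    by (simp add: lowering_raising assms algebra_simps)
qed

lemma gl_op_commutator:
  assumes "\<And>a i. w a i \<noteq> 0"
  shows "gl_op w a i j * gl_op w b k l - gl_op w b k l * gl_op w a i j =
    of_bool (a = b \<and> j = k) * gl_op w a i l - of_bool (a = b \<and> i = l) * gl_op w a k j"
proof -
  have "raising w b k * raising w a i * (lowering w b l * lowering w a j) =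
      raising w a i * raising w b k * (lowering w a j * lowering w b l)"
    by (simp only: raising_commute[of w b k a i] lowering_commute[of w b l a j])
  then show ?thesis
    unfolding gl_op_mult[OF assms] by (cases "a = b") (simp_all add: gl_op_def eq_commute[of l i])
qed

definition lin :: "(idx \<Rightarrow> idx \<Rightarrow> 'a) \<Rightarrow> idx \<Rightarrow> idx \<Rightarrow> nat \<Rightarrow> 'a::ring_1" where
  "lin E i j r = (if r = 0 then of_bool (i = j) else if r = 1 then E i j else 0)"

text \<open>The evaluation homomorphism: only superscripts 0 and 1 are nonzero in
  \<open>1 + E u^-1\<close>, and the RTT relation reduces to the commutation relations of
  gl_3.\<close>

lemma rtt_lin:
  assumes "\<And>i j k l. E i j * E k l - E k l * E i j = of_bool (j = k) * E i l - of_bool (i = l) * E k j"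
  shows "rtt (lin E)"
  unfolding rtt_def
proof (intro conjI allI)
  fix i j k l and r s :: nat
  have "r = 0 \<or> r = 1 \<or> r > 1" "s = 0 \<or> s = 1 \<or> s > 1" by auto
  then show "(lin E i j (Suc r) * lin E k l s - lin E k l s * lin E i j (Suc r)) -
      (lin E i j r * lin E k l (Suc s) - lin E k l (Suc s) * lin E i j r) =
      lin E k j r * lin E i l s - lin E k j s * lin E i l r"
    using assms[of i j k l] by (elim disjE) (auto simp: lin_def algebra_simps)
qed (simp add: lin_def)

text \<open>A tensor product of \<open>n\<close> evaluation modules. Factor \<open>a\<close> acts on
  site \<open>a\<close> only, so distinct factors commute.\<close>

fun modelT :: "(nat \<Rightarrow> idx \<Rightarrow> complex) \<Rightarrow> nat \<Rightarrow> idx \<Rightarrow> idx \<Rightarrow> nat \<Rightarrow> endo" where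
  "modelT w 0 = lin (\<lambda>_ _. 0)"
| "modelT w (Suc n) = conv (modelT w n) (lin (gl_op w n))"

lemma modelT_gl_op_commute:
  assumes "\<And>a i. w a i \<noteq> 0"
  shows "n \<le> b \<Longrightarrow> modelT w n i j r * gl_op w b k l = gl_op w b k l * modelT w n i j r"
proof (induction n arbitrary: i j r)
  case (Suc n)
  have "lin (gl_op w n) i' j' s * gl_op w b k l = gl_op w b k l * lin (gl_op w n) i' j' s" for i' j' s
    using gl_op_commutator[OF assms, where a = n and b = b and i = i' and j = j' and k = k and l = l]
      Suc.prems by (auto simp: lin_def)
  with Suc.IH Suc.prems have "modelT w n i i' s * lin (gl_op w n) i' j u * gl_op w b k l =
      gl_op w b k l * (modelT w n i i' s * lin (gl_op w n) i' j u)" for i' s u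
    by (metis Suc_leD mult.assoc)
  then show ?case
    by (simp add: conv_def sum_distrib_left sum_distrib_right)
qed (auto simp: lin_def)

lemma rtt_modelT:
  assumes "\<And>a i. w a i \<noteq> 0"
  shows "rtt (modelT w n)"
proof (induction n)
  case 0
  show ?case unfolding modelT.simps by (rule rtt_lin) simp
next
  case (Suc n)
  have "modelT w n i j r * lin (gl_op w n) k l s = lin (gl_op w n) k l s * modelT w n i j r" for i j r k l s
    using modelT_gl_op_commute[OF assms, of n n] by (auto simp: lin_def)
  moreover have "rtt (lin (gl_op w n))"
    using gl_op_commutator[OF assms] by (intro rtt_lin) simp
  ultimately show ?case
    unfolding modelT.simps by (intro rtt_conv Suc.IH) auto
qed

section \<open>Leading symbols\<close>

text \<open>Quantifying over all base points \<open>\<beta>\<close> makes this invariant under the translations in the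
  difference operators.\<close>

definition growth :: "point \<Rightarrow> nat \<Rightarrow> (point \<Rightarrow> complex) \<Rightarrow> complex \<Rightarrow> bool" where
  "growth \<kappa> e f \<rho> \<longleftrightarrow>
    (\<forall>\<beta>. ((\<lambda>t::real. f (\<lambda>a i. of_real t * \<kappa> a i + \<beta> a i) / of_real t ^ e) \<longlongrightarrow> \<rho>) at_top)"

text \<open>\<open>F\<close> has order at most \<open>d\<close> and principal symbol
  \<open>c\<close> in the direction \<open>\<kappa>\<close>, where \<open>c\<close> may be 0.
  Testing \<open>F\<close> on every function with known growth makes symbols multiplicative at
  once.\<close>

definition symbol :: "point \<Rightarrow> nat \<Rightarrow> endo \<Rightarrow> complex \<Rightarrow> bool" where
  "symbol \<kappa> d F c \<longleftrightarrow> (\<forall>e f \<rho>. growth \<kappa> e f \<rho> \<longrightarrow> growth \<kappa> (d + e) (app F f) (c * \<rho>))"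

lemma growth_one: "growth \<kappa> 0 (\<lambda>_. 1) 1"
  by (simp add: growth_def)

lemma growth_zero: "growth \<kappa> e (\<lambda>_. 0) 0"
  by (simp add: growth_def)

lemma growth_add: "growth \<kappa> e f \<rho> \<Longrightarrow> growth \<kappa> e g \<sigma> \<Longrightarrow> growth \<kappa> e (\<lambda>k. f k + g k) (\<rho> + \<sigma>)"
  by (simp add: growth_def add_divide_distrib tendsto_add)

lemma growth_scale: "growth \<kappa> e f \<rho> \<Longrightarrow> growth \<kappa> e (\<lambda>k. c * f k) (c * \<rho>)"
  unfolding growth_def times_divide_eq_right[symmetric] by (intro allI tendsto_mult tendsto_const) blast

lemma growth_move: "growth \<kappa> e f \<rho> \<Longrightarrow> growth \<kappa> e (\<lambda>k. f (move a i c k)) \<rho>"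
proof -
  assume f: "growth \<kappa> e f \<rho>"
  have "move a i c (\<lambda>b j. of_real t * \<kappa> b j + \<beta> b j) = (\<lambda>b j. of_real t * \<kappa> b j + move a i c \<beta> b j)"
    for t :: real and \<beta>
    by (auto simp: move_def fun_eq_iff)
  with f show ?thesis by (simp add: growth_def)
qed

lemma inverse_of_real_tendsto_0: "((\<lambda>t::real. 1 / of_real t :: complex) \<longlongrightarrow> 0) at_top"
proof -
  have "((\<lambda>t::real. of_real (inverse t) :: complex) \<longlongrightarrow> of_real 0) at_top"
    by (intro tendsto_of_real tendsto_inverse_0_at_top filterlim_ident)
  then show ?thesis by (simp add: inverse_eq_divide)
qed

lemma growth_coordinate:
  assumes "growth \<kappa> e f \<rho>"
  shows "growth \<kappa> (Suc e) (\<lambda>k. k a i * f k) (\<kappa> a i * \<rho>)"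
  unfolding growth_def
proof
  fix \<beta>
  have "((\<lambda>t::real. \<kappa> a i + \<beta> a i * (1 / of_real t)) \<longlongrightarrow> \<kappa> a i + \<beta> a i * 0) at_top"
    by (intro tendsto_intros inverse_of_real_tendsto_0)
  moreover have "\<forall>\<^sub>F t::real in at_top. \<kappa> a i + \<beta> a i * (1 / of_real t) = (of_real t * \<kappa> a i + \<beta> a i) / of_real t"
    using eventually_gt_at_top[of 0] by eventually_elim (simp add: field_simps)
  ultimately have "((\<lambda>t::real. (of_real t * \<kappa> a i + \<beta> a i) / of_real t) \<longlongrightarrow> \<kappa> a i) at_top"
    by (simp add: tendsto_cong)
  with assms have "((\<lambda>t::real. ((of_real t * \<kappa> a i + \<beta> a i) / of_real t) *
      (f (\<lambda>a i. of_real t * \<kappa> a i + \<beta> a i) / of_real t ^ e)) \<longlongrightarrow> \<kappa> a i * \<rho>) at_top"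
    unfolding growth_def by (intro tendsto_mult) blast+
  then show "((\<lambda>t::real. (of_real t * \<kappa> a i + \<beta> a i) * f (\<lambda>a i. of_real t * \<kappa> a i + \<beta> a i) /
      of_real t ^ Suc e) \<longlongrightarrow> \<kappa> a i * \<rho>) at_top"
    by simp
qed

lemma growth_Suc:
  assumes "growth \<kappa> e f \<rho>"
  shows "growth \<kappa> (Suc e) f 0"
  unfolding growth_def
proof
  fix \<beta>
  have "((\<lambda>t::real. (1 / of_real t) * (f (\<lambda>a i. of_real t * \<kappa> a i + \<beta> a i) / of_real t ^ e)) \<longlongrightarrow> 0 * \<rho>) at_top"
    using assms unfolding growth_def by (intro tendsto_mult inverse_of_real_tendsto_0) blast
  then show "((\<lambda>t::real. f (\<lambda>a i. of_real t * \<kappa> a i + \<beta> a i) / of_real t ^ Suc e) \<longlongrightarrow> 0) at_top"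
    by simp
qed

section \<open>Rules for symbols\<close>

lemma symbol_one: "symbol \<kappa> 0 1 1"
  by (simp add: symbol_def one_endo.rep_eq)

lemma symbol_zero: "symbol \<kappa> d 0 0"
  by (simp add: symbol_def zero_endo.rep_eq growth_zero)

lemma symbol_esc: "symbol \<kappa> 0 (esc c) c"
  by (simp add: symbol_def esc.rep_eq growth_scale)

lemma symbol_add: "symbol \<kappa> d F b \<Longrightarrow> symbol \<kappa> d G c \<Longrightarrow> symbol \<kappa> d (F + G) (b + c)"
  by (simp add: symbol_def plus_endo.rep_eq growth_add distrib_right)

lemma symbol_mult: "symbol \<kappa> d F b \<Longrightarrow> symbol \<kappa> e G c \<Longrightarrow> symbol \<kappa> (d + e) (F * G) (b * c)"
  by (simp add: symbol_def times_endo.rep_eq add.assoc mult.assoc)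

lemma symbol_lower: "symbol \<kappa> d F b \<Longrightarrow> d < e \<Longrightarrow> symbol \<kappa> e F 0"
proof (induction e)
  case (Suc e)
  then have "\<exists>c. symbol \<kappa> e F c" by (cases "d = e") auto
  then show ?case by (auto simp: symbol_def intro: growth_Suc)
qed simp

lemma symbol_sum: "(\<And>a. a \<in> A \<Longrightarrow> symbol \<kappa> d (F a) (c a)) \<Longrightarrow> symbol \<kappa> d (sum F A) (sum c A)"
  by (induction A rule: infinite_finite_induct) (simp_all add: symbol_zero symbol_add)

text \<open>Tested on the constant function 1, whose leading coefficient is not 0. This turns
  relations between operators into relations between symbols.\<close>

lemma symbol_zero_unique: "symbol \<kappa> d 0 c \<Longrightarrow> c = 0"
proof -
  assume "symbol \<kappa> d 0 c"
  then have "growth \<kappa> (d + 0) (app 0 (\<lambda>_. 1)) (c * 1)"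
    unfolding symbol_def using growth_one by blast
  then have "((\<lambda>t::real. 0 :: complex) \<longlongrightarrow> c) at_top"
    by (simp add: growth_def zero_endo.rep_eq)
  then show "c = 0"
    by (simp add: tendsto_const_iff)
qed

lemma symbol_lowering: "symbol \<kappa> 0 (lowering w a j) (w a j)"
  by (simp add: symbol_def lowering.rep_eq growth_scale growth_move)

lemma symbol_raising: "symbol \<kappa> 1 (raising w a i) (\<kappa> a i / w a i)"
proof -
  have "growth \<kappa> (Suc e) (\<lambda>k. k a i / w a i * f (move a i (- 1) k)) (\<kappa> a i / w a i * \<rho>)"
    if "growth \<kappa> e f \<rho>" for e f \<rho>
  proof -
    note growth_move[OF that, where a = a and i = i and c = "- 1"]
    note growth_coordinate[OF this, where a = a and i = i]
    from growth_scale[OF this, where c = "1 / w a i"] show ?thesis by simp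
  qed
  then show ?thesis by (simp add: symbol_def raising.rep_eq)
qed

lemma symbol_conv:
  assumes "\<And>i j r. symbol \<kappa> r (A i j r) (\<alpha> i j r)" "\<And>i j r. symbol \<kappa> r (B i j r) (\<beta> i j r)"
  shows "symbol \<kappa> r (conv A B i j r) (conv \<alpha> \<beta> i j r)"
proof -
  have "symbol \<kappa> r (A i k a * B k j (r - a)) (\<alpha> i k a * \<beta> k j (r - a))" if "a \<le> r" for k a
    using symbol_mult[OF assms(1)[of a i k] assms(2)[of "r - a" k j]] that by simp
  then show ?thesis
    unfolding conv_def by (intro symbol_sum) simp
qed

section \<open>Realizable symbols\<close>

text \<open>The symbol of \<open>1 + E u^-1\<close>, where \<open>E\<close> has become the rank one
  matrix of entries \<open>y i * w j\<close>.\<close>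

definition linM :: "(idx \<Rightarrow> complex) \<Rightarrow> (idx \<Rightarrow> complex) \<Rightarrow> complex fps ^ idx ^ idx" where
  "linM y w = (\<chi> i j. of_bool (i = j) + fps_const (y i * w j) * fps_X)"

fun modelM :: "(nat \<Rightarrow> idx \<Rightarrow> complex) \<Rightarrow> (nat \<Rightarrow> idx \<Rightarrow> complex) \<Rightarrow> nat \<Rightarrow> complex fps ^ idx ^ idx" where
  "modelM y w 0 = mat 1"
| "modelM y w (Suc n) = modelM y w n ** linM (y n) (w n)"

text \<open>The direction \<open>\<kappa> = y w\<close> is matched to the gauge:
  \<open>raising\<close> gets the symbol \<open>y\<close> and \<open>lowering\<close> the symbol
  \<open>w\<close>, so \<open>y\<close> is arbitrary and \<open>w\<close> any vector without zero
  entries.\<close>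

lemma symbol_modelT:
  assumes "\<And>a i. w a i \<noteq> 0" and \<kappa>: "\<kappa> = (\<lambda>a i. y a i * w a i)"
  shows "symbol \<kappa> r (modelT w n i j r) (modelM y w n $ i $ j $$ r)"
proof (induction n arbitrary: i j r)
  case 0
  then show ?case
    by (cases r) (auto simp: lin_def mat_def symbol_one symbol_zero)
next
  case (Suc n)
  define \<beta> where "\<beta> i j r = linM (y n) (w n) $ i $ j $$ r" for i j r
  have gl: "symbol \<kappa> (Suc 0) (gl_op w n i j) (y n i * w n j)" for i j
    using symbol_mult[OF symbol_raising symbol_lowering, of \<kappa> w n i w n j] assms(1)[of n i]
    by (simp add: gl_op_def \<kappa>)
  have "symbol \<kappa> r (lin (gl_op w n) i j r) (\<beta> i j r)" for i j r
  proof -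
    consider "r = 0" | "r = Suc 0" | "r > 1" by linarith
    then show ?thesis
      by cases (auto simp: lin_def \<beta>_def linM_def gl symbol_one symbol_zero)
  qed
  with Suc have "symbol \<kappa> r (conv (modelT w n) (lin (gl_op w n)) i j r)
      (conv (\<lambda>i j r. modelM y w n $ i $ j $$ r) \<beta> i j r)"
    by (intro symbol_conv)
  then show ?case
    by (simp add: conv_def matrix_matrix_mult_def fps_sum_nth fps_mult_nth \<beta>_def atMost_atLeast0)
qed

definition realizable :: "complex fps ^ idx ^ idx \<Rightarrow> bool" where
  "realizable P \<longleftrightarrow> (\<exists>n y w. (\<forall>a i. w a i \<noteq> 0) \<and> P = modelM y w n)"

lemma modelM_cong: "(\<And>a. a < n \<Longrightarrow> y a = y' a \<and> w a = w' a) \<Longrightarrow> modelM y w n = modelM y' w' n"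
  by (induction n) auto

lemma realizable_one: "realizable (mat 1)"
  unfolding realizable_def by (intro exI[of _ 0] exI[of _ undefined] exI[of _ "\<lambda>_ _. 1"]) simp

lemma realizable_linM:
  assumes "realizable P" "\<And>i. v i \<noteq> 0"
  shows "realizable (P ** linM u v)"
proof -
  obtain n y w where w: "\<forall>a i. w a i \<noteq> 0" and P: "P = modelM y w n"
    using assms(1) by (auto simp: realizable_def)
  have "modelM (y(n := u)) (w(n := v)) n = modelM y w n"
    by (rule modelM_cong) simp
  then have "P ** linM u v = modelM (y(n := u)) (w(n := v)) (Suc n)"
    by (simp add: P)
  moreover have "\<forall>a i. (w(n := v)) a i \<noteq> 0" using w assms(2) by simp
  ultimately show ?thesis unfolding realizable_def by blast
qed

text \<open>The matrix acting as \<open>f\<close> on the image of the idempotent \<open>e\<^sub>i v\<^sup>T\<close> (where \<open>v\<^sub>i = 1\<close>)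
  and trivially on its kernel.\<close>

definition idemM :: "idx \<Rightarrow> (idx \<Rightarrow> complex) \<Rightarrow> complex fps \<Rightarrow> complex fps ^ idx ^ idx" where
  "idemM i v f = (\<chi> a b. of_bool (a = b) + (if a = i then (f - 1) * fps_const (v b) else 0))"

text \<open>With \<open>e\<close> the idempotent,
  \<open>(1 + (f - 1) e) (1 + (g - 1) e) = 1 + (f g - 1) e\<close>.\<close>

lemma idemM_mult:
  assumes "v i = 1"
  shows "idemM i v f ** idemM i v g = idemM i v (f * g)"
  unfolding vec_eq_iff
proof (intro allI)
  fix a b
  define F G where "F = f - 1" and "G = g - 1"
  have "(idemM i v f ** idemM i v g) $ a $ b =
      (\<Sum>c\<in>UNIV. (of_bool (a = c) + (if a = i then F * fps_const (v c) else 0)) *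
        (of_bool (c = b) + (if c = i then G * fps_const (v b) else 0)))"
    by (simp add: matrix_matrix_mult_def idemM_def F_def G_def cong: if_cong)
  also have "\<dots> = of_bool (a = b) + (if a = i then (F + G + F * G) * fps_const (v b) else 0)"
    using assms by (cases "a = i")
      (simp_all add: distrib_left distrib_right sum.distrib of_bool_def if_zero_mult mult.assoc)
  also have "F + G + F * G = f * g - 1"
    by (simp add: F_def G_def algebra_simps)
  finally show "(idemM i v f ** idemM i v g) $ a $ b = idemM i v (f * g) $ a $ b"
    by (simp add: idemM_def)
qed

lemma idemM_one: "idemM i v 1 = mat 1"
  by (simp add: idemM_def mat_def vec_eq_iff)

lemma idemM_linear: "idemM i v (1 + fps_const c * fps_X) = linM (\<lambda>a. if a = i then c else 0) v"
  by (auto simp: idemM_def linM_def vec_eq_iff algebra_simps fps_const_mult[symmetric] simp del: fps_const_mult)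

lemma realizable_idemM:
  assumes "realizable P" "\<And>j. v j \<noteq> 0" "v i = 1"
  shows "realizable (P ** idemM i v (\<Prod>c\<leftarrow>cs. 1 + fps_const c * fps_X))"
  using assms(1)
proof (induction cs arbitrary: P)
  case Nil
  then show ?case by (simp add: idemM_one)
next
  case (Cons c cs)
  then show ?case
    using Cons.IH[OF realizable_linM[OF Cons.prems assms(2)]] assms(3)
    by (simp add: idemM_mult[symmetric] idemM_linear matrix_mul_assoc)
qed

text \<open>By the fundamental theorem of algebra; the value 1 at 0 makes every root nonzero, so
  each factor can be rescaled to constant term 1.\<close>

lemma poly_linear_factors:
  fixes q :: "complex poly"
  assumes "poly q 0 = 1"
  shows "\<exists>cs. q = (\<Prod>c\<leftarrow>cs. [:1, c:])"
  using assms
proof (induction "degree q" arbitrary: q)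
  case 0
  then obtain a where "q = [:a:]" by (metis degree_eq_zeroE)
  with 0 show ?case by (intro exI[of _ "[]"]) (simp add: one_pCons)
next
  case (Suc n)
  then obtain z where z: "poly q z = 0"
    using fundamental_theorem_of_algebra[of q] constant_degree[of q] by auto
  then obtain p where p: "q = [:- z, 1:] * p" by (metis poly_eq_0_iff_dvd dvdE)
  have "z \<noteq> 0" using z Suc.prems by auto
  define p' where "p' = smult (- z) p"
  have q: "q = [:1, - 1 / z:] * p'"
  proof -
    have "[:- z, 1:] = smult (- z) [:1, - 1 / z:]" using \<open>z \<noteq> 0\<close> by simp
    then show ?thesis by (simp only: p p'_def mult_smult_left mult_smult_right)
  qed
  have "p \<noteq> 0" using p Suc.prems by auto
  then have "degree q = Suc (degree p')"
    unfolding p p'_def using \<open>z \<noteq> 0\<close> by (subst degree_mult_eq) auto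
  moreover have "poly p' 0 = 1" using q Suc.prems by simp
  ultimately obtain cs where "p' = (\<Prod>c\<leftarrow>cs. [:1, c:])"
    using Suc.hyps by (metis Suc_inject)
  with q show ?case by (intro exI[of _ "(- 1 / z) # cs"]) simp
qed

text \<open>Each linear factor can be realized through \<open>linM\<close>; together they produce a
  change that starts only in order \<open>r\<close>.\<close>

lemma fps_linear_factors:
  assumes "r > 0"
  shows "\<exists>cs. 1 + fps_const c * fps_X ^ r = (\<Prod>c\<leftarrow>cs. 1 + fps_const c * fps_X :: complex fps)"
proof -
  have "poly (1 + monom c r) 0 = 1" using assms by (simp add: poly_monom)
  then obtain cs where cs: "1 + monom c r = (\<Prod>c\<leftarrow>cs. [:1, c:])" using poly_linear_factors by blast
  have "fps_of_poly (\<Prod>c\<leftarrow>cs. [:1, c:]) = (\<Prod>c\<leftarrow>cs. 1 + fps_const c * fps_X)"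
    by (simp add: fps_of_poly_prod_list o_def fps_of_poly_linear')
  moreover have "fps_of_poly (1 + monom c r) = 1 + fps_const c * fps_X ^ r"
    by (simp add: fps_of_poly_add fps_of_poly_monom)
  ultimately show ?thesis using cs by metis
qed

text \<open>Order \<open>r\<close> can be changed by \<open>D\<close> with all lower orders kept;
  higher orders may change in an uncontrolled way.\<close>

definition adjustable :: "nat \<Rightarrow> (idx \<Rightarrow> idx \<Rightarrow> complex) \<Rightarrow> bool" where
  "adjustable r D \<longleftrightarrow> (\<forall>P. realizable P \<longrightarrow>
    (\<exists>Q. realizable Q \<and> (\<forall>i j. (\<forall>s<r. Q $ i $ j $$ s = P $ i $ j $$ s) \<and>
      Q $ i $ j $$ r = P $ i $ j $$ r + D i j)))"

lemma adjustable_add: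
  assumes "adjustable r D" "adjustable r D'"
  shows "adjustable r (\<lambda>i j. D i j + D' i j)"
  unfolding adjustable_def
proof (intro allI impI)
  fix P assume "realizable P"
  then obtain Q where Q: "realizable Q" "\<And>i j. (\<forall>s<r. Q $ i $ j $$ s = P $ i $ j $$ s) \<and>
      Q $ i $ j $$ r = P $ i $ j $$ r + D i j"
    using assms(1) unfolding adjustable_def by metis
  then obtain Q' where "realizable Q'" "\<And>i j. (\<forall>s<r. Q' $ i $ j $$ s = Q $ i $ j $$ s) \<and>
      Q' $ i $ j $$ r = Q $ i $ j $$ r + D' i j"
    using assms(2) unfolding adjustable_def by metis
  with Q show "\<exists>Q. realizable Q \<and> (\<forall>i j. (\<forall>s<r. Q $ i $ j $$ s = P $ i $ j $$ s) \<and>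
      Q $ i $ j $$ r = P $ i $ j $$ r + (D i j + D' i j))"
    by (intro exI[of _ Q']) (simp add: add.assoc)
qed

lemma modelM_nth_0: "modelM y w n $ i $ j $$ 0 = of_bool (i = j)"
  by (induction n arbitrary: i j)
    (simp_all add: mat_def matrix_matrix_mult_def fps_sum_nth linM_def of_bool_def if_zero_mult)

lemma realizable_nth_0: "realizable P \<Longrightarrow> P $ i $ j $$ 0 = of_bool (i = j)"
  by (auto simp: realizable_def modelM_nth_0)

text \<open>Right multiplication by \<open>1 + u^-r e_i x^T\<close> adds \<open>e_i x^T\<close> in
  order \<open>r\<close>, because \<open>P\<close> starts with the identity matrix.\<close>

lemma adjustable_row_nz:
  assumes "r > 0" "\<And>j. x j \<noteq> 0"
  shows "adjustable r (\<lambda>a b. if a = i then x b else 0)"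
  unfolding adjustable_def
proof (intro allI impI)
  fix P assume P: "realizable P"
  \<comment> \<open>Scaled to \<open>v i = 1\<close>, as \<open>idemM\<close> requires; the factor
    \<open>x i\<close> goes into the series.\<close>
  define v where "v j = x j / x i" for j
  define Q where "Q = P ** idemM i v (1 + fps_const (x i) * fps_X ^ r)"
  obtain cs where "1 + fps_const (x i) * fps_X ^ r = (\<Prod>c\<leftarrow>cs. 1 + fps_const c * fps_X)"
    using fps_linear_factors[OF assms(1)] by blast
  then have "realizable Q"
    unfolding Q_def using P assms(2) by (auto simp: v_def intro: realizable_idemM)
  have "Q $ a $ b = P $ a $ b + fps_const (x b) * P $ a $ i * fps_X ^ r" for a b
  proof -
    have "Q $ a $ b = (\<Sum>c\<in>UNIV. P $ a $ c * of_bool (c = b)) +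
        (\<Sum>c\<in>UNIV. P $ a $ c * (if c = i then fps_const (x i) * fps_X ^ r * fps_const (v b) else 0))"
      by (simp add: Q_def matrix_matrix_mult_def idemM_def distrib_left sum.distrib cong: if_cong)
    also have "fps_const (x i) * fps_X ^ r * fps_const (v b) = fps_const (x i * v b) * fps_X ^ r"
      by (simp add: mult_ac flip: fps_const_mult)
    also have "x i * v b = x b" using assms(2) by (simp add: v_def)
    finally show ?thesis by (simp add: if_zero_mult of_bool_def mult_ac)
  qed
  then have "Q $ a $ b $$ s = P $ a $ b $$ s + (if s < r then 0 else x b * P $ a $ i $$ (s - r))" for a b s
    by (simp add: fps_X_power_mult_right_nth mult.assoc)
  with \<open>realizable Q\<close> P show "\<exists>Q. realizable Q \<and> (\<forall>a b. (\<forall>s<r. Q $ a $ b $$ s = P $ a $ b $$ s) \<and>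
      Q $ a $ b $$ r = P $ a $ b $$ r + (if a = i then x b else 0))"
    by (intro exI[of _ Q]) (auto simp: realizable_nth_0)
qed

lemma adjustable_row:
  assumes "r > 0"
  shows "adjustable r (\<lambda>a b. if a = i then x b else 0)"
proof -
  \<comment> \<open>Neither \<open>u\<close> nor \<open>x - u\<close> has a zero entry, so
    \<open>x\<close> is a sum of two rows that \<open>adjustable_row_nz\<close> covers.\<close>
  define u where "u b = (if x b = 1 then 2 else 1 :: complex)" for b
  have "adjustable r (\<lambda>a b. (if a = i then x b - u b else 0) + (if a = i then u b else 0))"
    by (intro adjustable_add adjustable_row_nz assms) (auto simp: u_def)
  moreover have "(if a = i then x b - u b else 0) + (if a = i then u b else 0) = (if a = i then x b else 0)" for a b
    by simp
  ultimately show ?thesis by simp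
qed

lemma adjustable_all:
  assumes "r > 0"
  shows "adjustable r D"
proof -
  have "adjustable r (\<lambda>a b. (if a = Sgn Minus then D (Sgn Minus) b else 0) +
      ((if a = Zero then D Zero b else 0) + (if a = Sgn Plus then D (Sgn Plus) b else 0)))"
    by (intro adjustable_add adjustable_row assms)
  moreover have "(if a = Sgn Minus then D (Sgn Minus) b else 0) +
      ((if a = Zero then D Zero b else 0) + (if a = Sgn Plus then D (Sgn Plus) b else 0)) = D a b" for a b
    using UNIV_idx by (cases a; cases "case a of Sgn s \<Rightarrow> s") auto
  ultimately show ?thesis by simp
qed

text \<open>The coefficients are corrected one order at a time.\<close>

lemma realizable_dense:
  assumes "\<And>i j. \<tau> i j 0 = of_bool (i = j)"
  shows "\<exists>P. realizable P \<and> (\<forall>i j. \<forall>r\<le>N. P $ i $ j $$ r = \<tau> i j r)"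
proof (induction N)
  case 0
  show ?case
    by (rule exI[of _ "mat 1"]) (simp add: realizable_one realizable_nth_0 assms)
next
  case (Suc N)
  then obtain P where P: "realizable P" "\<And>i j r. r \<le> N \<Longrightarrow> P $ i $ j $$ r = \<tau> i j r" by blast
  have "adjustable (Suc N) (\<lambda>i j. \<tau> i j (Suc N) - P $ i $ j $$ Suc N)"
    by (rule adjustable_all) simp
  with P(1) obtain Q where "realizable Q" "\<forall>i j. (\<forall>s<Suc N. Q $ i $ j $$ s = P $ i $ j $$ s) \<and>
      Q $ i $ j $$ Suc N = P $ i $ j $$ Suc N + (\<tau> i j (Suc N) - P $ i $ j $$ Suc N)"
    unfolding adjustable_def by blast
  with P(2) show ?case
    by (intro exI[of _ Q]) (auto simp: le_Suc_eq less_Suc_eq_le)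
qed

section \<open>Prescribing the symbols of the Drinfeld generators\<close>

text \<open>The substitution of \<open>- u\<close> for \<open>u\<close>.\<close>

definition bar :: "complex fps \<Rightarrow> complex fps" where
  "bar f = Abs_fps (\<lambda>n. (- 1) ^ n * f $$ n)"

lemma bar_nth: "bar f $$ n = (- 1) ^ n * f $$ n"
  by (simp add: bar_def)

lemma bar_add: "bar (f + g) = bar f + bar g"
  by (simp add: bar_def fps_eq_iff algebra_simps)

lemma bar_mult: "bar (f * g) = bar f * bar g"
proof -
  have "(\<Sum>i=0..n. (- 1) ^ n * (f $$ i * g $$ (n - i))) =
      (\<Sum>i=0..n. (- 1) ^ i * f $$ i * ((- 1) ^ (n - i) * g $$ (n - i)))" for n
  proof (intro sum.cong refl)
    fix i assume "i \<in> {0..n}"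
    then have "(- 1 :: complex) ^ n = (- 1) ^ i * (- 1) ^ (n - i)"
      by (simp flip: power_add)
    then show "(- 1) ^ n * (f $$ i * g $$ (n - i)) = (- 1) ^ i * f $$ i * ((- 1) ^ (n - i) * g $$ (n - i))"
      by simp
  qed
  then show ?thesis
    by (simp add: bar_def fps_eq_iff fps_mult_nth sum_distrib_left)
qed

lemma bar_bar: "bar (bar f) = f"
  by (simp add: bar_def fps_eq_iff flip: mult.assoc power_mult_distrib)

fun flip :: "pm \<Rightarrow> pm" where
  "flip Minus = Plus"
| "flip Plus = Minus"

lemma uminus_Sgn: "- Sgn a = Sgn (flip a)"
  by (cases a) simp_all

definition targetE :: "(label \<Rightarrow> complex) \<Rightarrow> pm \<Rightarrow> complex fps" where
  "targetE v a = Abs_fps (\<lambda>r. if r = 0 then 0 else v (EGen a r))"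

definition targetG :: "(label \<Rightarrow> complex) \<Rightarrow> complex fps" where
  "targetG v = Abs_fps (\<lambda>r. if r = 0 then 1 else if even r then v (GGen r) else 0)"

text \<open>For leading symbols the symmetry relation becomes
  \<open>S_{-j,-i}(-u) = S_{i,j}(u)\<close>. The admissible coefficients stay free and it forces the
  others.\<close>

fun targetD :: "(label \<Rightarrow> complex) \<Rightarrow> pm \<Rightarrow> pm \<Rightarrow> complex fps" where
  "targetD v Minus Minus = Abs_fps (\<lambda>r. if r = 0 then 1 else v (DGen Minus Minus r))"
| "targetD v Plus Plus = bar (Abs_fps (\<lambda>r. if r = 0 then 1 else v (DGen Minus Minus r)))"
| "targetD v a b = Abs_fps (\<lambda>r. if r > 0 \<and> even r then v (DGen a b r) else 0)"

definition targetX :: "(label \<Rightarrow> complex) \<Rightarrow> pm \<Rightarrow> complex fps" where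
  "targetX v a = (\<Sum>b\<in>UNIV. targetD v a b * targetE v b)"

text \<open>The Gauss decomposition read backwards: the column is \<open>D E\<close>, the row its
  image under the symmetry, the corner \<open>G\<close> plus the row times \<open>E\<close>.\<close>

fun targetS :: "(label \<Rightarrow> complex) \<Rightarrow> idx \<Rightarrow> idx \<Rightarrow> complex fps" where
  "targetS v (Sgn a) (Sgn b) = targetD v a b"
| "targetS v (Sgn a) Zero = targetX v a"
| "targetS v Zero (Sgn a) = bar (targetX v (flip a))"
| "targetS v Zero Zero = targetG v + (\<Sum>a\<in>UNIV. bar (targetX v (flip a)) * targetE v a)"

lemma bar_targetD: "bar (targetD v (flip b) (flip a)) = targetD v a b"
  by (cases a; cases b) (auto simp: bar_bar, auto simp: bar_def fps_eq_iff)

lemma bar_targetG: "bar (targetG v) = targetG v"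
  by (auto simp: targetG_def bar_def fps_eq_iff)

lemma targetS_symmetric: "bar (targetS v (- j) (- i)) = targetS v i j"
proof -
  have flip: "flip (flip a) = a" for a by (cases a) simp_all
  \<comment> \<open>The correction to \<open>G\<close> in the corner pairs \<open>E\<close> with
    \<open>bar E\<close> through the matrix \<open>D\<close> and inherits the symmetry of
    \<open>D\<close>; \<open>G\<close> itself is even.\<close>
  have "bar (targetS v Zero Zero) = targetS v Zero Zero"
    using bar_targetD[of v Minus Plus] bar_targetD[of v Plus Minus]
    bar_targetD[of v Minus Minus] bar_targetD[of v Plus Plus]
    by (simp add: bar_add bar_mult bar_bar bar_targetG UNIV_pm targetX_def algebra_simps
        del: targetD.simps)
  then show ?thesis
    by (cases i; cases j) (simp_all add: uminus_Sgn bar_targetD bar_bar flip del: targetS.simps(4))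
qed

lemma targetD_0: "targetD v a b $$ 0 = of_bool (a = b)"
  by (cases a; cases b) (simp_all add: bar_def)

lemma targetX_0: "targetX v a $$ 0 = 0"
  by (simp add: targetX_def fps_sum_nth targetE_def)

lemma targetS_0: "targetS v i j $$ 0 = of_bool (i = j)"
  by (cases i; cases j) (simp_all add: targetD_0 targetX_0 bar_def targetG_def fps_sum_nth)

text \<open>The square root of \<open>s\<close> with constant term 1: the equation of each order is
  solved for the newest coefficient, which occurs in it twice.\<close>

fun msqrt :: "(idx \<Rightarrow> idx \<Rightarrow> nat \<Rightarrow> complex) \<Rightarrow> nat \<Rightarrow> idx \<Rightarrow> idx \<Rightarrow> complex" where
  "msqrt s 0 i j = of_bool (i = j)"
| "msqrt s (Suc n) i j =
    (s i j (Suc n) - (\<Sum>a\<in>{1..n}. \<Sum>k\<in>UNIV. msqrt s a i k * msqrt s (Suc n - a) k j)) / 2"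

lemma msqrt_square:
  assumes "\<And>i j. s i j 0 = of_bool (i = j)"
  shows "(\<Sum>k\<in>UNIV. \<Sum>a\<le>r. msqrt s a i k * msqrt s (r - a) k j) = s i j r"
proof (cases r)
  case 0
  then show ?thesis by (simp add: assms of_bool_def if_zero_mult)
next
  case (Suc n)
  have "{..Suc n} = insert 0 (insert (Suc n) {1..n})" by auto
  then have "(\<Sum>a\<le>Suc n. \<Sum>k\<in>UNIV. msqrt s a i k * msqrt s (Suc n - a) k j) =
      2 * msqrt s (Suc n) i j + (\<Sum>a\<in>{1..n}. \<Sum>k\<in>UNIV. msqrt s a i k * msqrt s (Suc n - a) k j)"
    by (simp add: of_bool_def if_zero_mult del: msqrt.simps(2))
  also have "\<dots> = s i j (Suc n)" by (simp add: field_simps)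
  finally show ?thesis unfolding Suc by (subst sum.swap)
qed

text \<open>The symmetry reverses products and fixes \<open>s\<close>, hence the root, by induction
  on the order. Consequently \<open>yU\<close> gets the same symbols as \<open>yT\<close>, and
  \<open>S\<close> gets their square.\<close>

lemma msqrt_symmetric:
  assumes "\<And>i j r. (- 1) ^ r * s (- j) (- i) r = s i j r"
  shows "(- 1) ^ r * msqrt s r (- j) (- i) = msqrt s r i j"
proof (induction r arbitrary: i j rule: less_induct)
  case (less r)
  show ?case
  proof (cases r)
    case (Suc n)
    have "(- 1) ^ r * (\<Sum>a\<in>{1..n}. \<Sum>k\<in>UNIV. msqrt s a (- j) k * msqrt s (r - a) k (- i)) =
        (\<Sum>a\<in>{1..n}. \<Sum>k\<in>UNIV. (- 1) ^ r * (msqrt s a (- j) (- k) * msqrt s (r - a) (- k) (- i)))"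
      by (simp add: sum_distrib_left sum_uminus_idx[of "\<lambda>k. _ * (msqrt s _ _ k * msqrt s _ k _)"])
    also have "\<dots> = (\<Sum>a\<in>{1..n}. \<Sum>k\<in>UNIV. msqrt s (r - a) i k * msqrt s a k j)"
    proof (intro sum.cong refl)
      fix a k assume "a \<in> {1..n}"
      then have a: "a < r" "r - a < r" "a + (r - a) = r" using Suc by auto
      then have "(- 1 :: complex) ^ r = (- 1) ^ a * (- 1) ^ (r - a)"
        by (simp flip: power_add)
      then show "(- 1) ^ r * (msqrt s a (- j) (- k) * msqrt s (r - a) (- k) (- i)) =
          msqrt s (r - a) i k * msqrt s a k j"
        using less[OF a(1), of j k] less[OF a(2), of k i] by (simp add: mult_ac)
    qed
    also have "\<dots> = (\<Sum>a\<in>{1..n}. \<Sum>k\<in>UNIV. msqrt s a i k * msqrt s (r - a) k j)"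
      unfolding Suc by (subst sum.atLeastAtMost_rev) (simp add: Suc_diff_le)
    finally show ?thesis
      using assms[of r j i] unfolding Suc msqrt.simps
      by (simp only: times_divide_eq_right right_diff_distrib)
  qed simp
qed

lemma symbol_uminus: "symbol \<kappa> d F b \<Longrightarrow> symbol \<kappa> d (- F) (- b)"
proof -
  have "esc (- 1) = - 1"
    by (rule endo_eqI) (simp add: esc.rep_eq endo_rep_eq)
  then show "symbol \<kappa> d F b \<Longrightarrow> symbol \<kappa> d (- F) (- b)"
    using symbol_mult[OF symbol_esc, of \<kappa> d F b "- 1"] by simp
qed

lemma symbol_diff: "symbol \<kappa> d F b \<Longrightarrow> symbol \<kappa> d G c \<Longrightarrow> symbol \<kappa> d (F - G) (b - c)"
  using symbol_add[of \<kappa> d F b "- G" "- c"] symbol_uminus by simp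

lemma symbol_mult': "symbol \<kappa> d F b \<Longrightarrow> symbol \<kappa> e G c \<Longrightarrow> d + e = n \<Longrightarrow> symbol \<kappa> n (F * G) (b * c)"
  using symbol_mult by blast

lemma symbol_sign: "symbol \<kappa> d F b \<Longrightarrow> symbol \<kappa> d ((- 1) ^ n * F) ((- 1) ^ n * b)"
  by (cases "even n") (simp_all add: symbol_uminus)

text \<open>Giving \<open>T\<close> the square root of \<open>targetS v\<close> as its symbols, up
  to order \<open>N\<close>, gives \<open>S\<close> the symbols \<open>targetS v\<close>; the
  recursions for \<open>E\<close> and \<open>G\<close> then return the prescribed values
  \<open>v\<close>.\<close>

lemma drinfeld_symbols:
  obtains \<Phi> \<kappa> where "\<And>x y. \<Phi> (x + y) = \<Phi> x + \<Phi> y" "\<And>x y. \<Phi> (x * y) = \<Phi> x * \<Phi> y"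
    "\<Phi> 1 = 1" "\<And>a x. \<Phi> (yscale a x) = esc a * \<Phi> x"
    "\<And>l. l \<in> pbw_labels \<Longrightarrow> weight l \<le> N \<Longrightarrow> symbol \<kappa> (weight l) (\<Phi> (drinfeld l)) (v l)"
proof -
  define s where "s i j r = targetS v i j $$ r" for i j r
  define \<tau> where "\<tau> i j r = msqrt s r i j" for i j r
  have s_sym: "(- 1) ^ r * s (- j) (- i) r = s i j r" for i j r
    unfolding s_def targetS_symmetric[of v j i, symmetric] by (simp add: bar_def)
  obtain n y w where w: "\<forall>a i. w a i \<noteq> 0"
    and \<tau>: "\<And>i j r. r \<le> N \<Longrightarrow> modelM y w n $ i $ j $$ r = \<tau> i j r"
    using realizable_dense[of \<tau> N] unfolding realizable_def by (auto simp: \<tau>_def)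
  define \<kappa> where "\<kappa> = (\<lambda>a i. y a i * w a i)"
  obtain \<Phi> where \<Phi>: "\<Phi> 1 = 1" "\<And>x y. \<Phi> (x + y) = \<Phi> x + \<Phi> y" "\<And>x y. \<Phi> (x * y) = \<Phi> x * \<Phi> y"
    "\<And>a x. \<Phi> (yscale a x) = esc a * \<Phi> x" and \<Phi>T: "\<And>i j r. \<Phi> (yT i j r) = modelT w n i j r"
    by (rule endo.yangian_hom[OF rtt_modelT[of w n]], use w in blast, rule that)
  have \<Phi>0: "\<Phi> 0 = 0" using \<Phi>(2)[of 0 0] by simp
  have \<Phi>u: "\<Phi> (- x) = - \<Phi> x" for x
    using \<Phi>(2)[of x "- x"] \<Phi>0 by (simp add: add_eq_0_iff)
  have \<Phi>d: "\<Phi> (x - z) = \<Phi> x - \<Phi> z" for x z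
    using \<Phi>(2)[of x "- z"] \<Phi>u by simp
  have \<Phi>s: "\<Phi> (sum f A) = (\<Sum>a\<in>A. \<Phi> (f a))" for f :: "'b \<Rightarrow> yangian3" and A
    by (induction A rule: infinite_finite_induct) (simp_all add: \<Phi> \<Phi>0)
  have \<Phi>sign: "\<Phi> ((- 1) ^ r * x) = (- 1) ^ r * \<Phi> x" for r x
    by (cases "even r") (simp_all add: \<Phi>u)
  have T: "symbol \<kappa> r (\<Phi> (yT i j r)) (\<tau> i j r)" if "r \<le> N" for i j r
    using symbol_modelT[of w \<kappa> y r n i j] w \<tau>[OF that] by (simp add: \<Phi>T \<kappa>_def)
  have U: "symbol \<kappa> r (\<Phi> (yU i j r)) (\<tau> i j r)" if "r \<le> N" for i j r
    using symbol_sign[OF T[OF that, of "- j" "- i"], of r] msqrt_symmetric[of s r j i] s_sym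
    by (simp add: yU_def \<Phi>sign \<tau>_def)
  have S: "symbol \<kappa> r (\<Phi> (yS i j r)) (s i j r)" if "r \<le> N" for i j r
  proof -
    have "symbol \<kappa> r (\<Phi> (yS i j r)) (\<Sum>k\<in>UNIV. \<Sum>a\<le>r. \<tau> i k a * \<tau> k j (r - a))"
      unfolding yS_def conv_def \<Phi>s \<Phi> using that by (intro symbol_sum symbol_mult'[OF U T]) auto
    also have "(\<Sum>k\<in>UNIV. \<Sum>a\<le>r. \<tau> i k a * \<tau> k j (r - a)) = s i j r"
      unfolding \<tau>_def by (rule msqrt_square) (simp add: s_def targetS_0)
    finally show ?thesis .
  qed
  \<comment> \<open>The target obeys the recursion of \<open>yS_Sgn_Zero\<close>, so the symbols of
    \<open>yE\<close> follow by induction.\<close>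
  have sE: "s (Sgn a) Zero r = targetE v a $$ r + (\<Sum>b\<in>UNIV. \<Sum>t<r. s (Sgn a) (Sgn b) (r - t) * targetE v b $$ t)" for a r
    by (simp add: s_def targetX_def fps_sum_nth fps_mult_nth_split[of "targetD _ _ _"] targetD_0
        sum.distrib of_bool_def if_zero_mult del: targetD.simps)
  have E: "symbol \<kappa> r (\<Phi> (yE a r)) (targetE v a $$ r)" if "r \<le> N" for a r
    using that
  proof (induction r arbitrary: a rule: less_induct)
    case (less r)
    have "symbol \<kappa> r (\<Phi> (yS (Sgn a) Zero r) - (\<Sum>b\<in>UNIV. \<Sum>t<r. \<Phi> (yS (Sgn a) (Sgn b) (r - t)) * \<Phi> (yE b t)))
      (s (Sgn a) Zero r - (\<Sum>b\<in>UNIV. \<Sum>t<r. s (Sgn a) (Sgn b) (r - t) * targetE v b $$ t))"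
      using less by (intro symbol_diff symbol_sum symbol_mult'[OF S less.IH] S) auto
    then show ?case
      unfolding yS_Sgn_Zero[of a r] sE by (simp add: \<Phi> \<Phi>s)
  qed
  have sG: "s Zero Zero r = targetG v $$ r + (\<Sum>a\<in>UNIV. \<Sum>t<r. s Zero (Sgn a) (r - t) * targetE v a $$ t)" for r
    by (simp add: s_def fps_sum_nth fps_mult_nth_split[of "bar _"] targetX_0 bar_nth)
  have G: "symbol \<kappa> r (\<Phi> (Gser $$ r)) (targetG v $$ r)" if "r \<le> N" for r
  proof -
    have "symbol \<kappa> r (\<Phi> (yS Zero Zero r) - (\<Sum>a\<in>UNIV. \<Sum>t<r. \<Phi> (yS Zero (Sgn a) (r - t)) * \<Phi> (yE a t)))
      (s Zero Zero r - (\<Sum>a\<in>UNIV. \<Sum>t<r. s Zero (Sgn a) (r - t) * targetE v a $$ t))"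
      using that by (intro symbol_diff symbol_sum symbol_mult'[OF S E] S) auto
    then show ?thesis
      unfolding yS_Zero_Zero[of r] sG by (simp add: \<Phi> \<Phi>s)
  qed
  have "symbol \<kappa> (weight l) (\<Phi> (drinfeld l)) (v l)" if "l \<in> pbw_labels" "weight l \<le> N" for l
  proof (cases l)
    case (EGen a m)
    then show ?thesis using that E[of m a] by (auto simp: pbw_labels_def yE_def targetE_def)
  next
    case (DGen a b r)
    then have "s (Sgn a) (Sgn b) r = v l"
      using that(1) by (cases a; cases b) (auto simp: pbw_labels_def s_def admissible_def)
    then show ?thesis using that S[of r "Sgn a" "Sgn b"] by (auto simp: DGen Dser_def Sser_eq)
  next
    case (GGen t)
    then show ?thesis using that G[of t] by (auto simp: pbw_labels_def targetG_def)
  qed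
  from that[OF \<Phi>(2,3,1,4) this] show thesis .
qed

section \<open>Linear independence\<close>

text \<open>A polynomial in finitely many variables vanishing everywhere has zero coefficients.
  Multisets encode monomials, and one variable \<open>x\<close> is split off at a time.\<close>

lemma monomials_independent:
  fixes f :: "'i \<Rightarrow> 'x multiset" and c :: "'i \<Rightarrow> complex"
  assumes "finite L" "finite I" "inj_on f I" "\<And>i. i \<in> I \<Longrightarrow> set_mset (f i) \<subseteq> L"
    and "\<And>v. (\<Sum>i\<in>I. c i * prod_mset (image_mset v (f i))) = 0" and "i \<in> I"
  shows "c i = 0"
  using assms
proof (induction L arbitrary: I f c i rule: finite_induct)
  case empty
  have f: "f j = {#}" if "j \<in> I" for j using empty.prems(3)[OF that] by simp
  have eq: "j = i" if "j \<in> I" for j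
    using inj_onD[OF empty.prems(2), of j i] f that empty.prems(5) by simp
  have "I = {i}" using eq empty.prems(5) by blast
  with f empty.prems(4) show ?case by simp
next
  case (insert x L)
  define f' where "f' j = filter_mset (\<lambda>y. y \<noteq> x) (f j)" for j
  have f: "f j = f' j + replicate_mset (count (f j) x) x" for j
    by (rule multiset_eqI) (simp add: f'_def)
  define J where "J k = {j \<in> I. count (f j) x = k}" for k
  have "(\<Sum>j\<in>J k. c j * prod_mset (image_mset v (f' j))) = 0" for k v
  proof -
    define b where "b k = (\<Sum>j\<in>J k. c j * prod_mset (image_mset v (f' j)))" for k
    \<comment> \<open>A degree bound in \<open>x\<close>; it includes \<open>k\<close> so that
      \<open>b k\<close> is among the coefficients compared.\<close>
    obtain m where m: "\<And>j. j \<in> I \<Longrightarrow> count (f j) x \<le> m" "k \<le> m"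
    proof
      show "count (f j) x \<le> Max (insert k ((\<lambda>j. count (f j) x) ` I))" if "j \<in> I" for j
        using that insert.prems(1) by (intro Max_ge) auto
      show "k \<le> Max (insert k ((\<lambda>j. count (f j) x) ` I))"
        using insert.prems(1) by (intro Max_ge) auto
    qed
    have "(\<Sum>k\<le>m. b k * z ^ k) = 0" for z
    proof -
      \<comment> \<open>No \<open>f' j\<close> contains \<open>x\<close>, so the coefficients
        \<open>b k\<close> do not change with the value \<open>z\<close> at
        \<open>x\<close>.\<close>
      have v: "image_mset (v(x := z)) (f' j) = image_mset v (f' j)" for j
        by (rule image_mset_cong) (auto simp: f'_def)
      have summand: "c j * prod_mset (image_mset v (f' j)) * z ^ k =
          c j * prod_mset (image_mset (v(x := z)) (f j))" if "j \<in> J k" for j k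
        using that by (subst f) (simp add: J_def v)
      have "(\<Sum>k\<le>m. b k * z ^ k) = (\<Sum>k\<le>m. \<Sum>j\<in>J k. c j * prod_mset (image_mset (v(x := z)) (f j)))"
        unfolding b_def sum_distrib_right by (intro sum.cong refl summand)
      also have "\<dots> = (\<Sum>j\<in>I. c j * prod_mset (image_mset (v(x := z)) (f j)))"
        unfolding J_def using m(1) insert.prems(1) by (intro sum.group) auto
      finally show ?thesis using insert.prems(4) by simp
    qed
    then have "\<forall>k\<le>m. b k = 0" by (intro polyfun_eq_0[THEN iffD1] allI)
    then have "b k = 0" using m(2) by simp
    then show ?thesis unfolding b_def .
  qed
  \<comment> \<open>The exponent of \<open>x\<close> is constant on this set, so \<open>f' j\<close>
    determines \<open>f j\<close>.\<close>
  moreover have "inj_on f' (J (count (f i) x))"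
  proof (rule inj_onI)
    fix j k assume "j \<in> J (count (f i) x)" "k \<in> J (count (f i) x)" "f' j = f' k"
    then show "j = k"
      using f[of j] f[of k] by (intro inj_onD[OF insert.prems(2)]) (simp_all add: J_def)
  qed
  moreover have "set_mset (f' j) \<subseteq> L" if "j \<in> J k" for j k
    using that insert.prems(3)[of j] by (auto simp: J_def f'_def)
  moreover have "finite (J (count (f i) x))" "i \<in> J (count (f i) x)"
    using insert.prems(1,5) by (simp_all add: J_def)
  ultimately show ?case
    by (intro insert.IH[of "J (count (f i) x)" f' c i])
qed

text \<open>Among the words with nonzero coefficient, only those of maximal weight \<open>d\<close>
  survive in the symbol of order \<open>d\<close>. As \<open>v\<close> is arbitrary, this is a
  polynomial vanishing identically.\<close>

lemma pbw_relation_trivial: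
  assumes "linear_order_on pbw_labels ord" "finite W" "W \<subseteq> ordered_words ord"
    and "(\<Sum>xs\<in>W. yscale (c xs) (pbw_monomial xs)) = 0" "xs \<in> W"
  shows "c xs = 0"
proof (rule ccontr)
  assume "c xs \<noteq> 0"
  define wt where "wt ys = sum_list (map weight ys)" for ys
  define W' where "W' = {ys \<in> W. c ys \<noteq> 0}"
  have W': "finite W'" "W' \<noteq> {}" using assms \<open>c xs \<noteq> 0\<close> by (auto simp: W'_def)
  define d where "d = Max (wt ` W')"
  define I where "I = {ys \<in> W'. wt ys = d}"
  have "d \<in> wt ` W'" unfolding d_def using W' by (intro Max_in) auto
  then obtain zs where zs: "zs \<in> I" by (auto simp: I_def)
  have le: "wt ys \<le> d" if "ys \<in> W'" for ys
    unfolding d_def using W' that by (intro Max_ge) auto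
  have words: "set ys \<subseteq> pbw_labels" if "ys \<in> W'" for ys
    using that assms(3) by (auto simp: W'_def ordered_words_def)
  have zero: "(\<Sum>ys\<in>I. c ys * prod_mset (image_mset v (mset ys))) = 0" for v
  proof -
    obtain \<Phi> \<kappa> where \<Phi>: "\<And>x y. \<Phi> (x + y) = \<Phi> x + \<Phi> y" "\<And>x y. \<Phi> (x * y) = \<Phi> x * \<Phi> y"
        "\<Phi> 1 = 1" "\<And>a x. \<Phi> (yscale a x) = esc a * \<Phi> x"
      and v: "\<And>l. l \<in> pbw_labels \<Longrightarrow> weight l \<le> d \<Longrightarrow> symbol \<kappa> (weight l) (\<Phi> (drinfeld l)) (v l)"
      by (rule drinfeld_symbols[of d v], rule that)
    have \<Phi>0: "\<Phi> 0 = 0" using \<Phi>(1)[of 0 0] by simp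
    have \<Phi>s: "\<Phi> (sum f A) = (\<Sum>a\<in>A. \<Phi> (f a))" for f :: "label list \<Rightarrow> yangian3" and A
      by (induction A rule: infinite_finite_induct) (simp_all add: \<Phi> \<Phi>0)
    have mon: "symbol \<kappa> (wt ys) (\<Phi> (pbw_monomial ys)) (prod_mset (image_mset v (mset ys)))"
      if "set ys \<subseteq> pbw_labels" "wt ys \<le> d" for ys
      using that
    proof (induction ys)
      case Nil
      then show ?case by (simp add: pbw_monomial_def \<Phi> wt_def symbol_one)
    next
      case (Cons l ys)
      then show ?case
        using symbol_mult[OF v[of l] Cons.IH] by (simp add: pbw_monomial_def \<Phi> wt_def)
    qed
    \<comment> \<open>Words of weight below \<open>d\<close> have symbol 0 in order
      \<open>d\<close>.\<close>
    have "symbol \<kappa> d (\<Phi> (yscale (c ys) (pbw_monomial ys)))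
        (if ys \<in> I then c ys * prod_mset (image_mset v (mset ys)) else 0)" if "ys \<in> W'" for ys
    proof -
      have "symbol \<kappa> (wt ys) (\<Phi> (yscale (c ys) (pbw_monomial ys)))
          (c ys * prod_mset (image_mset v (mset ys)))"
        using symbol_mult[OF symbol_esc mon[OF words[OF that] le[OF that]]] by (simp add: \<Phi>)
      then show ?thesis
        using that le[OF that] symbol_lower by (auto simp: I_def)
    qed
    then have "symbol \<kappa> d (\<Sum>ys\<in>W'. \<Phi> (yscale (c ys) (pbw_monomial ys)))
        (\<Sum>ys\<in>W'. if ys \<in> I then c ys * prod_mset (image_mset v (mset ys)) else 0)"
      by (intro symbol_sum)
    moreover have "(\<Sum>ys\<in>W'. \<Phi> (yscale (c ys) (pbw_monomial ys))) = 0"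
    proof -
      have "(\<Sum>ys\<in>W'. yscale (c ys) (pbw_monomial ys)) = (\<Sum>ys\<in>W. yscale (c ys) (pbw_monomial ys))"
        using assms(2) by (intro sum.mono_neutral_left) (auto simp: W'_def)
      then show ?thesis using assms(4) by (simp add: \<Phi>s[symmetric] \<Phi>0)
    qed
    moreover have "(\<Sum>ys\<in>W'. if ys \<in> I then c ys * prod_mset (image_mset v (mset ys)) else 0) =
        (\<Sum>ys\<in>I. c ys * prod_mset (image_mset v (mset ys)))"
      using W'(1) by (simp add: sum.inter_restrict[symmetric]) (rule sum.cong, auto simp: I_def)
    ultimately show ?thesis using symbol_zero_unique by metis
  qed
  \<comment> \<open>A sorted word is determined by its multiset of letters, so distinct words give
    distinct commutative monomials.\<close>
  have "inj_on mset I"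
    using linear_order_on_sorted_unique[OF assms(1)] assms(3)
    by (auto simp: inj_on_def I_def W'_def ordered_words_def)
  moreover have "finite I" using W' by (simp add: I_def)
  ultimately have "c zs = 0"
    using monomials_independent[of "\<Union>(set ` I)" I mset c zs] zero zs by auto
  with zs show False by (simp add: I_def W'_def)
qed

text \<open>Independence of the image set would not notice two words with equal monomials;
  injectivity excludes this.\<close>

theorem theorem1p2:
  fixes ord :: "label rel"
  assumes "linear_order_on pbw_labels ord"
  shows "inj_on pbw_monomial (ordered_words ord) \<and>
    Y.independent (pbw_monomial ` ordered_words ord) \<and>
    Y.span (pbw_monomial ` ordered_words ord) = twisted_yangian"
proof (intro conjI span_ordered_words[OF assms])
  show inj: "inj_on pbw_monomial (ordered_words ord)"
  proof (rule inj_onI, rule ccontr)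
    fix xs ys
    assume xy: "xs \<in> ordered_words ord" "ys \<in> ordered_words ord"
      "pbw_monomial xs = pbw_monomial ys" "xs \<noteq> ys"
    define c where "c zs = (if zs = xs then 1 else - 1 :: complex)" for zs
    have "(\<Sum>zs\<in>{xs, ys}. yscale (c zs) (pbw_monomial zs)) = 0"
      using xy by (simp add: c_def)
    from pbw_relation_trivial[OF assms _ _ this, of xs] xy show False
      by (simp add: c_def)
  qed
  show "Y.independent (pbw_monomial ` ordered_words ord)"
    unfolding Y.independent_explicit_module
  proof (intro allI impI)
    fix t u b
    assume t: "finite t" "t \<subseteq> pbw_monomial ` ordered_words ord"
      "(\<Sum>b\<in>t. yscale (u b) b) = 0" "b \<in> t"
    then obtain W where W: "W \<subseteq> ordered_words ord" "finite W" "t = pbw_monomial ` W"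
      by (meson finite_subset_image)
    \<comment> \<open>The relation is pulled back from monomials to words, where injectivity
      prevents repetitions.\<close>
    then have "(\<Sum>xs\<in>W. yscale (u (pbw_monomial xs)) (pbw_monomial xs)) = 0"
      using t(3) inj_on_subset[OF inj W(1)] by (simp add: sum.reindex)
    from pbw_relation_trivial[OF assms W(2,1) this] t(4) W(3) show "u b = 0" by auto
  qed
qed

end
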